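(* Let $(\Omega,\Sigma,P)$ be a probability space, $(\Upsilon,T)$ a measurable space, $d\in\mathbb{N}$, and let $\{X_i\}_{i\in I}$ be an infinite family of $\Sigma$-$T$-measurable maps from $\Omega$ into $\Upsilon$. Consider the following assertions: (i) $\{X_i\}_{i\in I}$ is $P$-exchangeable. (ii) There exists a $\sigma$-subalgebra $\mathcal{F}$ of $\Sigma$ such that $\{X_i\}_{i\in I}$ is $P$-conditionally i.i.d. over $\mathcal{F}$. (iii) There exist a $\sigma$-subalgebra $\mathcal{F}$ of $\Sigma$ and a Markov kernel $\{Q_\omega\}_{\omega\in\Omega}$ from $(\Omega,\mathcal{F})$ to $(\Upsilon,T)$ such that $$\int_FQ_\omega^I(H)\,R(d\omega)=P(F\cap X^{-1}(H))$$ for every $H\in T_I$ and $F\in\mathcal{F}$, where $R:=P\mid\mathcal{F}$, $Q_\omega^I$ is the $I$-fold product probability of copies of $Q_\omega$ on $T_I$, and $X:\Omega\to\Upsilon^I$ is $X(\omega)=(X_i(\omega))_{i\in I}$. (iv) There exists a $\Sigma$-$\mathfrak{B}(\mathbb{R}^d)$-measurable map $\Theta:\Omega\to\mathbb{R}^d$ such that $\{X_i\}_{i\in I}$ is $P$-conditionally i.i.d. given $\Theta$. Then (i)$\Leftrightarrow$(ii), (iii)$\Rightarrow$(i) and (iv)$\Rightarrow$(i). If any one of conditions (i) to (iv) is satisfied, then all image measures $P_{X_i}$ are equal. Moreover, if $P_{X_i}$ is perfect for every $i\in I$ and $T$ is countably generated, then assertions (i) to (iv) are equivalent.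
   Context: $P_{X_i}:=P\circ X_i^{-1}$ on $T$. $T_I:=\bigotimes_{i\in I}T$ is the product $\sigma$-algebra on $\Upsilon^I$. A Markov kernel $\{Q_\omega\}$ from $(\Omega,\mathcal{F})$ to $(\Upsilon,T)$: each $Q_\omega$ is a probability measure on $T$ and $\omega\mapsto Q_\omega(B)$ is $\mathcal{F}$-measurable for each $B\in T$. An infinite family $\{X_i\}_{i\in I}$ is $P$-exchangeable if for each $r\in\mathbb{N}$, $P(\bigcap_{k=1}^rX_{i_k}^{-1}(B_k))=P(\bigcap_{k=1}^rX_{j_k}^{-1}(B_k))$ whenever $i_1,\dots,i_r\in I$ are distinct, $j_1,\dots,j_r\in I$ are distinct and $B_k\in T$. $\{X_i\}_{i\in I}$ is $P$-conditionally independent over $\mathcal{F}$ if for each $n\ge2$, distinct $i_1,\dots,i_n$ and $E_j\in\sigma(X_{i_j})$, $P(\bigcap_jE_j\mid\mathcal{F})=\prod_jP(E_j\mid\mathcal{F})$ a.s.; $P$-conditionally identically distributed over $\mathcal{F}$ if $P(F\cap X_i^{-1}(B))=P(F\cap X_j^{-1}(B))$ for all $i,j\in I$, $F\in\mathcal{F}$, $B\in T$; conditionally i.i.d. means both; "given $\Theta$" means over $\sigma(\Theta)$. A probability measure $\mu$ on a measurable space $(S,\mathcal{S})$ is perfect if for every measurable $f:S\to\mathbb{R}$ there is a Borel set $B\subseteq f(S)$ with $\mu(f^{-1}(B))=1$. A $\sigma$-algebra is countably generated if it is generated by a countable family of sets. *)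

theory Defs
  imports "HOL-Probability.Probability"
begin

text \<open>
  Throughout, a value of type \<^typ>\<open>'a measure\<close> is also used to represent a bare measurable
  space or a bare \<open>\<sigma>\<close>-algebra; then only its \<^const>\<open>space\<close> and \<^const>\<open>sets\<close> matter.
\<close>

definition countably_generated :: "'b measure \<Rightarrow> bool" where
  "countably_generated T \<longleftrightarrow>
     (\<exists>C. countable C \<and> C \<subseteq> Pow (space T) \<and> sets T = sigma_sets (space T) C)"

definition perfect :: "'b measure \<Rightarrow> bool" where
  "perfect \<mu> \<longleftrightarrow> prob_space \<mu> \<and>
     (\<forall>f :: 'b \<Rightarrow> real. f \<in> borel_measurable \<mu> \<longrightarrow>
        (\<exists>B \<in> sets borel. B \<subseteq> f ` space \<mu> \<and> measure \<mu> (f -` B \<inter> space \<mu>) = 1))"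

definition exchangeable ::
  "'a measure \<Rightarrow> 'b measure \<Rightarrow> ('i \<Rightarrow> 'a \<Rightarrow> 'b) \<Rightarrow> 'i set \<Rightarrow> bool" where
  "exchangeable P T X I \<longleftrightarrow>
     (\<forall>r \<ge> 1. \<forall>i j :: nat \<Rightarrow> 'i. \<forall>B :: nat \<Rightarrow> 'b set.
        inj_on i {1..r} \<longrightarrow> i ` {1..r} \<subseteq> I \<longrightarrow>
        inj_on j {1..r} \<longrightarrow> j ` {1..r} \<subseteq> I \<longrightarrow>
        (\<forall>k \<in> {1..r}. B k \<in> sets T) \<longrightarrow>
        measure P (\<Inter>k\<in>{1..r}. X (i k) -` B k \<inter> space P) =
        measure P (\<Inter>k\<in>{1..r}. X (j k) -` B k \<inter> space P))"

abbreviation gen_sigma :: "'a measure \<Rightarrow> 'b measure \<Rightarrow> ('a \<Rightarrow> 'b) \<Rightarrow> 'a measure" where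
  "gen_sigma P T Y \<equiv> vimage_algebra (space P) Y T"

abbreviation cond_prob_over :: "'a measure \<Rightarrow> 'a measure \<Rightarrow> 'a set \<Rightarrow> 'a \<Rightarrow> real" where
  "cond_prob_over P F E \<equiv> real_cond_exp P F (indicator E)"

definition cond_indep ::
  "'a measure \<Rightarrow> 'a measure \<Rightarrow> 'b measure \<Rightarrow> ('i \<Rightarrow> 'a \<Rightarrow> 'b) \<Rightarrow> 'i set \<Rightarrow> bool" where
  "cond_indep P F T X I \<longleftrightarrow>
     (\<forall>n \<ge> 2. \<forall>i :: nat \<Rightarrow> 'i. \<forall>E :: nat \<Rightarrow> 'a set.
        inj_on i {1..n} \<longrightarrow> i ` {1..n} \<subseteq> I \<longrightarrow>
        (\<forall>j \<in> {1..n}. E j \<in> sets (gen_sigma P T (X (i j)))) \<longrightarrow>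
        (AE \<omega> in P. cond_prob_over P F (\<Inter>j\<in>{1..n}. E j) \<omega> =
                    (\<Prod>j\<in>{1..n}. cond_prob_over P F (E j) \<omega>)))"

definition cond_ident_distr ::
  "'a measure \<Rightarrow> 'a measure \<Rightarrow> 'b measure \<Rightarrow> ('i \<Rightarrow> 'a \<Rightarrow> 'b) \<Rightarrow> 'i set \<Rightarrow> bool" where
  "cond_ident_distr P F T X I \<longleftrightarrow>
     (\<forall>i \<in> I. \<forall>j \<in> I. \<forall>A \<in> sets F. \<forall>B \<in> sets T.
        measure P (A \<inter> X i -` B) = measure P (A \<inter> X j -` B))"

definition cond_iid ::
  "'a measure \<Rightarrow> 'a measure \<Rightarrow> 'b measure \<Rightarrow> ('i \<Rightarrow> 'a \<Rightarrow> 'b) \<Rightarrow> 'i set \<Rightarrow> bool" where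
  "cond_iid P F T X I \<longleftrightarrow> cond_indep P F T X I \<and> cond_ident_distr P F T X I"

end

theory Submission
  imports Defs
begin

text \<open>
  Pick a sequence of distinct indices. For an exchangeable family the empirical frequencies of a set \<open>B\<close>
  along this sequence are Cauchy in \<open>L\<^sup>2\<close> with an explicit rate, so they converge almost surely along a
  sparse subsequence to a function measurable for the tail \<open>\<sigma>\<close>-algebra. In an integral against a bounded
  tail function each factor \<open>indicator B (X i)\<close> may be replaced by \<open>indicator B (X j)\<close> with \<open>j\<close> far out in the
  sequence; averaging over \<open>j\<close> replaces it by the limiting frequency. Hence the family is conditionally
  i.i.d. over the tail \<open>\<sigma>\<close>-algebra.

  If \<open>T\<close> is countably generated, it is the preimage of the Borel sets under some \<open>f : \<Upsilon> \<rightarrow> [0,1]\<close>. The limiting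
  frequencies of the sets \<open>f \<le> q\<close>, \<open>q\<close> rational, give a random distribution function, and perfectness pulls
  the corresponding random measure back to \<open>T\<close>. Only countably many random variables are involved, and
  they are coded into a single real random variable \<open>\<Theta>\<close> by the same Cantor set construction as \<open>f\<close>.
\<close>

section \<open>Conditional independence from a directing random function\<close>

text \<open>Two obstacles shape the proof. The null set in an identity about frequencies depends on
  the sets involved, and \<open>T\<close> may contain uncountably many; at a fixed \<omega> nothing
  makes \<open>B\<close> \<mapsto> \<open>freq B \<omega>\<close> additive. Hence the general part
  works with integral identities over tail events, for finitely many sets at a time, which is all
  that conditional independence and identical distribution ask for. A kernel, however, must be a
  measure at every \<omega>. On the line, rational levels suffice, since monotonicity and right
  limits determine a distribution function. Transport back along \<open>f\<close> meets the second
  obstacle: the image of \<open>f\<close> need not be Borel. Perfectness supplies a Borel part of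
  the image that carries the law. The resulting kernel depends on \<omega> only through the
  frequencies at rational levels, so it is measurable for the \<sigma>-algebra they generate, which
  lies inside the tail and inherits the product formula. So one kernel, over \<sigma>(\<Theta>),
  serves both (iii) and (iv).\<close>

definition hits :: "('k \<Rightarrow> 'a \<Rightarrow> 'b) \<Rightarrow> 'k set \<Rightarrow> ('k \<Rightarrow> 'b set) \<Rightarrow> 'a \<Rightarrow> real" where
  "hits Y K B \<omega> = (\<Prod>k\<in>K. indicator (B k) (Y k \<omega>))"

lemma hits_nonneg: "0 \<le> hits Y K B \<omega>"
  unfolding hits_def by (intro prod_nonneg) auto

lemma hits_le_1: "hits Y K B \<omega> \<le> 1"
  unfolding hits_def by (intro prod_le_1) (auto simp: indicator_def)

lemma measurable_hits [measurable]:
  assumes "\<And>k. k \<in> K \<Longrightarrow> Y k \<in> M \<rightarrow>\<^sub>M T" "\<And>k. k \<in> K \<Longrightarrow> B k \<in> sets T"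
  shows "hits Y K B \<in> borel_measurable M"
proof -
  have "(\<lambda>\<omega>. indicator (B k) (Y k \<omega>) :: real) \<in> borel_measurable M" if "k \<in> K" for k
    using assms[OF that] by measurable
  then show ?thesis
    unfolding hits_def by (intro borel_measurable_prod)
qed

lemma hits_eq_of_bool: "finite K \<Longrightarrow> hits Y K B \<omega> = of_bool (\<forall>k\<in>K. Y k \<omega> \<in> B k)"
  unfolding hits_def by (induction K rule: finite_induct) (auto simp: indicator_def)

lemma hits_eq_indicator:
  assumes "finite K" "K \<noteq> {}" "\<omega> \<in> space M"
  shows "hits Y K B \<omega> = indicator (\<Inter>k\<in>K. Y k -` B k \<inter> space M) \<omega>"
  using assms by (auto simp: hits_eq_of_bool indicator_def)

lemma (in prob_space) integrable_bounded_01: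
  assumes "f \<in> borel_measurable M" "\<And>\<omega>. 0 \<le> f \<omega>" "\<And>\<omega>. f \<omega> \<le> (1::real)"
  shows "integrable M f"
  using assms by (intro integrable_const_bound[of _ 1]) auto

lemma (in prob_space) integral_hits_eq_prob:
  assumes "finite K" "K \<noteq> {}" "A \<in> events"
    and "\<And>k. k \<in> K \<Longrightarrow> Y k \<in> M \<rightarrow>\<^sub>M T" "\<And>k. k \<in> K \<Longrightarrow> B k \<in> sets T"
  shows "(\<integral>\<omega>. indicator A \<omega> * hits Y K B \<omega> \<partial>M) = prob (A \<inter> (\<Inter>k\<in>K. Y k -` B k \<inter> space M))"
proof -
  have *: "(\<Inter>k\<in>K. Y k -` B k \<inter> space M) \<in> events"
    using assms by (intro sets.finite_INT) (auto intro: measurable_sets)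
  have "(\<integral>\<omega>. indicator A \<omega> * hits Y K B \<omega> \<partial>M)
      = (\<integral>\<omega>. indicator (A \<inter> (\<Inter>k\<in>K. Y k -` B k \<inter> space M)) \<omega> \<partial>M)"
    by (intro Bochner_Integration.integral_cong)
       (simp_all add: hits_eq_indicator[OF assms(1,2)] indicator_inter_arith)
  also have "\<dots> = prob (A \<inter> (\<Inter>k\<in>K. Y k -` B k \<inter> space M))"
    using * assms(3) sets.Int_space_eq2 by (subst Bochner_Integration.integral_indicator) (auto simp: emeasure_eq_measure Int_absorb2 sets.sets_into_space)
  finally show ?thesis .
qed

lemma (in prob_space) subalgebra_sigma_finite:
  "subalgebra M F \<Longrightarrow> sigma_finite_subalgebra M F"
  by (intro finite_measure_subalgebra_is_sigma_finite)
     (simp add: finite_measure_subalgebra_def finite_measure_subalgebra_axioms_def finite_measure_axioms)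

locale random_family = prob_space P for P :: "'a measure" +
  fixes T :: "'b measure" and X :: "'i \<Rightarrow> 'a \<Rightarrow> 'b" and I :: "'i set"
  assumes random_variable [measurable]: "i \<in> I \<Longrightarrow> X i \<in> P \<rightarrow>\<^sub>M T"
begin

text \<open>The random function \<open>W\<close> plays the role of de Finetti's directing random measure, except that
  \<open>B \<mapsto> W B \<omega>\<close> need not be a measure; without regularity of \<open>T\<close> nothing better is available.\<close>

definition directed_by :: "'a measure \<Rightarrow> ('b set \<Rightarrow> 'a \<Rightarrow> real) \<Rightarrow> bool" where
  "directed_by F W \<longleftrightarrow> subalgebra P F \<and>
     (\<forall>B \<in> sets T. W B \<in> borel_measurable F \<and> (\<forall>\<omega>. 0 \<le> W B \<omega> \<and> W B \<omega> \<le> 1)) \<and>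
     (\<forall>A \<in> sets F. \<forall>J B. finite J \<longrightarrow> J \<subseteq> I \<longrightarrow> (\<forall>i \<in> J. B i \<in> sets T) \<longrightarrow>
        (\<integral>\<omega>. indicator A \<omega> * hits X J B \<omega> \<partial>P) = (\<integral>\<omega>. indicator A \<omega> * (\<Prod>i\<in>J. W (B i) \<omega>) \<partial>P))"

text \<open>\<open>directed_by\<close> indexes sets by elements of \<open>I\<close>, whereas
  \<open>cond_indep\<close> enumerates variables; injectivity of \<open>i\<close> allows the sets to
  be carried over with \<open>inv_into\<close>.\<close>

lemma directed_by_reindex:
  fixes i :: "'k \<Rightarrow> 'i"
  assumes W: "directed_by F W" and A: "A \<in> sets F" and K: "finite K" "inj_on i K" "i ` K \<subseteq> I"
    and B: "\<And>k. k \<in> K \<Longrightarrow> B k \<in> sets T"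
  shows "(\<integral>\<omega>. indicator A \<omega> * hits (\<lambda>k. X (i k)) K B \<omega> \<partial>P)
       = (\<integral>\<omega>. indicator A \<omega> * (\<Prod>k\<in>K. W (B k) \<omega>) \<partial>P)"
proof -
  define B' where "B' = B \<circ> inv_into K i"
  have B': "B' (i k) = B k" if "k \<in> K" for k
    using that K by (simp add: B'_def)
  have "hits X (i ` K) B' \<omega> = hits (\<lambda>k. X (i k)) K B \<omega>" for \<omega>
    using K by (simp add: hits_def prod.reindex B')
  moreover have "(\<Prod>j\<in>i ` K. W (B' j) \<omega>) = (\<Prod>k\<in>K. W (B k) \<omega>)" for \<omega>
    using K by (simp add: prod.reindex B')
  moreover have "\<forall>j\<in>i ` K. B' j \<in> sets T"
    using B by (auto simp: B')
  ultimately show ?thesis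
    using W[unfolded directed_by_def, THEN conjunct2, THEN conjunct2, rule_format, of A "i ` K" B'] A K
    by auto
qed

text \<open>Read over all \<open>A\<close> in \<open>F\<close>, the integral identity in
  \<open>directed_by\<close> is the characterization of a conditional probability, because the
  product on its right is \<open>F\<close>-measurable.\<close>

lemma directed_by_cond_prob:
  fixes i :: "'k \<Rightarrow> 'i"
  assumes W: "directed_by F W" and K: "finite K" "K \<noteq> {}" "inj_on i K" "i ` K \<subseteq> I"
    and B: "\<And>k. k \<in> K \<Longrightarrow> B k \<in> sets T"
  shows "AE \<omega> in P. cond_prob_over P F (\<Inter>k\<in>K. X (i k) -` B k \<inter> space P) \<omega> = (\<Prod>k\<in>K. W (B k) \<omega>)"
proof -
  have F: "subalgebra P F" and Wm: "\<And>k. k \<in> K \<Longrightarrow> W (B k) \<in> borel_measurable F"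
    and W01: "\<And>k \<omega>. k \<in> K \<Longrightarrow> 0 \<le> W (B k) \<omega>" "\<And>k \<omega>. k \<in> K \<Longrightarrow> W (B k) \<omega> \<le> 1"
    using W B unfolding directed_by_def by auto
  interpret sigma_finite_subalgebra P F
    using F by (rule subalgebra_sigma_finite)
  have E: "(\<Inter>k\<in>K. X (i k) -` B k \<inter> space P) \<in> events"
    using K B random_variable by (intro sets.finite_INT) (auto intro!: measurable_sets[of _ P T])
  have prodm: "(\<lambda>\<omega>. \<Prod>k\<in>K. W (B k) \<omega>) \<in> borel_measurable F"
    by (intro borel_measurable_prod Wm)
  show ?thesis
  proof (rule real_cond_exp_charact)
    fix A assume A: "A \<in> sets F"
    then have AP: "A \<in> events" using F by (auto simp: subalgebra_def)
    have "(\<integral>\<omega>\<in>A. indicator (\<Inter>k\<in>K. X (i k) -` B k \<inter> space P) \<omega> \<partial>P)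
        = (\<integral>\<omega>. indicator A \<omega> * hits (\<lambda>k. X (i k)) K B \<omega> \<partial>P)"
      unfolding set_lebesgue_integral_def
      by (intro Bochner_Integration.integral_cong)
         (simp_all add: hits_eq_indicator[OF K(1,2), where M=P])
    also have "\<dots> = (\<integral>\<omega>\<in>A. (\<Prod>k\<in>K. W (B k) \<omega>) \<partial>P)"
      unfolding set_lebesgue_integral_def using directed_by_reindex[OF W A K(1,3,4) B] by simp
    finally show "(\<integral>\<omega>\<in>A. indicator (\<Inter>k\<in>K. X (i k) -` B k \<inter> space P) \<omega> \<partial>P)
        = (\<integral>\<omega>\<in>A. (\<Prod>k\<in>K. W (B k) \<omega>) \<partial>P)" .
  next
    show "integrable P (indicator (\<Inter>k\<in>K. X (i k) -` B k \<inter> space P) :: 'a \<Rightarrow> real)"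
      using E by (simp add: emeasure_eq_measure)
    show "integrable P (\<lambda>\<omega>. \<Prod>k\<in>K. W (B k) \<omega>)"
      using measurable_from_subalg[OF F prodm] W01
      by (intro integrable_bounded_01 prod_nonneg prod_le_1) auto
  qed (rule prodm)
qed

lemma directed_by_imp_cond_iid:
  assumes W: "directed_by F W"
  shows "cond_iid P F T X I"
  unfolding cond_iid_def
proof
  have F: "subalgebra P F" using W by (simp add: directed_by_def)
  show "cond_indep P F T X I"
    unfolding cond_indep_def
  proof (intro allI impI)
    fix n :: nat and i :: "nat \<Rightarrow> 'i" and E :: "nat \<Rightarrow> 'a set"
    assume n: "2 \<le> n" and i: "inj_on i {1..n}" "i ` {1..n} \<subseteq> I"
      and E: "\<forall>j\<in>{1..n}. E j \<in> sets (gen_sigma P T (X (i j)))"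
    have "\<exists>B. B \<in> sets T \<and> E j = X (i j) -` B \<inter> space P" if "j \<in> {1..n}" for j
    proof -
      have "X (i j) \<in> space P \<rightarrow> space T"
        using measurable_space[OF random_variable, of "i j"] that i by blast
      from sets_vimage_algebra2[OF this] show ?thesis
        using E[rule_format, OF that] by blast
    qed
    then obtain B where B: "\<And>j. j \<in> {1..n} \<Longrightarrow> B j \<in> sets T"
      and EB: "\<And>j. j \<in> {1..n} \<Longrightarrow> E j = X (i j) -` B j \<inter> space P"
      by metis
    have AE1: "AE \<omega> in P. cond_prob_over P F (\<Inter>j\<in>{1..n}. X (i j) -` B j \<inter> space P) \<omega>
        = (\<Prod>j\<in>{1..n}. W (B j) \<omega>)"
      using n by (intro directed_by_cond_prob[OF W] i B) auto
    \<comment> \<open>A one-element index set identifies each factor with \<open>W (B j)\<close>;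
      only finitely many null sets are involved.\<close>
    have AE2: "AE \<omega> in P. \<forall>j\<in>{1..n}. cond_prob_over P F (E j) \<omega> = W (B j) \<omega>"
    proof (intro AE_finite_allI)
      fix j assume j: "j \<in> {1..n}"
      have "AE \<omega> in P. cond_prob_over P F (\<Inter>k\<in>{j}. X (i k) -` B k \<inter> space P) \<omega> = (\<Prod>k\<in>{j}. W (B k) \<omega>)"
        using i j B by (intro directed_by_cond_prob[OF W]) auto
      then show "AE \<omega> in P. cond_prob_over P F (E j) \<omega> = W (B j) \<omega>"
        by (simp add: EB[OF j])
    qed simp
    have EI: "(\<Inter>j\<in>{1..n}. E j) = (\<Inter>j\<in>{1..n}. X (i j) -` B j \<inter> space P)"
      by (intro INF_cong refl EB)
    show "AE \<omega> in P. cond_prob_over P F (\<Inter>j\<in>{1..n}. E j) \<omega>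
        = (\<Prod>j\<in>{1..n}. cond_prob_over P F (E j) \<omega>)"
      unfolding EI using AE1 AE2 by eventually_elim (auto intro!: prod.cong)
  qed
  have "measure P (A \<inter> X i -` B) = (\<integral>\<omega>. indicator A \<omega> * W B \<omega> \<partial>P)"
    if "i \<in> I" "A \<in> sets F" "B \<in> sets T" for i A B
  proof -
    have A: "A \<in> events" using F that by (auto simp: subalgebra_def)
    have "(\<integral>\<omega>. indicator A \<omega> * hits X {i} (\<lambda>_. B) \<omega> \<partial>P) = prob (A \<inter> (\<Inter>k\<in>{i}. X k -` B \<inter> space P))"
      using that A random_variable by (intro integral_hits_eq_prob[where T=T]) auto
    moreover have "(\<integral>\<omega>. indicator A \<omega> * hits X {i} (\<lambda>_. B) \<omega> \<partial>P)
        = (\<integral>\<omega>. indicator A \<omega> * (\<Prod>k\<in>{i}. W B \<omega>) \<partial>P)"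
      using directed_by_reindex[OF W \<open>A \<in> sets F\<close>, of "{i}" "\<lambda>k. k" "\<lambda>_. B"] that by simp
    moreover have "A \<inter> (X i -` B \<inter> space P) = A \<inter> X i -` B"
      using sets.sets_into_space[OF A] by auto
    ultimately show ?thesis by simp
  qed
  then show "cond_ident_distr P F T X I"
    by (simp add: cond_ident_distr_def)
qed

section \<open>Exchangeability from conditional independence and from product kernels\<close>

text \<open>Integrating the product formula expresses a joint probability through conditional
  probabilities of single events, and identical distribution over \<open>F\<close> makes each of
  these almost surely independent of the index.\<close>

lemma cond_iid_imp_exchangeable:
  assumes F: "subalgebra P F" and iid: "cond_iid P F T X I"
  shows "exchangeable P T X I"
  unfolding exchangeable_def
proof (intro allI impI)
  fix r :: nat and i j :: "nat \<Rightarrow> 'i" and B :: "nat \<Rightarrow> 'b set"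
  assume r: "1 \<le> r" and i: "inj_on i {1..r}" "i ` {1..r} \<subseteq> I"
    and j: "inj_on j {1..r}" "j ` {1..r} \<subseteq> I" and B: "\<forall>k\<in>{1..r}. B k \<in> sets T"
  interpret sigma_finite_subalgebra P F
    using F by (rule subalgebra_sigma_finite)
  have ev: "X l -` B k \<inter> space P \<in> events" if "l \<in> I" "k \<in> {1..r}" for l k
    using that B random_variable by (auto intro: measurable_sets)
  have eq: "prob (A \<inter> (X (i k) -` B k \<inter> space P)) = prob (A \<inter> (X (j k) -` B k \<inter> space P))"
    if A: "A \<in> sets F" and k: "k \<in> {1..r}" for A k
  proof -
    have "A \<subseteq> space P"
      using A F sets.sets_into_space[of A P] by (auto simp: subalgebra_def)
    then have "A \<inter> (Y -` B k \<inter> space P) = A \<inter> Y -` B k" for Y :: "'a \<Rightarrow> 'b"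
      by auto
    then show ?thesis
      using iid A k B i j unfolding cond_iid_def cond_ident_distr_def
      by (simp add: image_subset_iff)
  qed
  show "prob (\<Inter>k\<in>{1..r}. X (i k) -` B k \<inter> space P) = prob (\<Inter>k\<in>{1..r}. X (j k) -` B k \<inter> space P)"
  \<comment> \<open>\<open>cond_indep\<close> speaks of at least two variables, so a single variable
    is settled by identical distribution on the whole space.\<close>
  proof (cases "r = 1")
    case True
    have "space P \<in> sets F"
      using F sets.top[of F] by (simp add: subalgebra_def)
    from eq[OF this, of 1] show ?thesis
      by (simp add: True Int_absorb1)
  next
    case False
    with r have r2: "2 \<le> r" by simp
    have int: "prob (\<Inter>k\<in>{1..r}. X (l k) -` B k \<inter> space P)
        = (\<integral>\<omega>. (\<Prod>k\<in>{1..r}. cond_prob_over P F (X (l k) -` B k \<inter> space P) \<omega>) \<partial>P)"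
      if l: "inj_on l {1..r}" "l ` {1..r} \<subseteq> I" for l
    proof -
      let ?E = "\<Inter>k\<in>{1..r}. X (l k) -` B k \<inter> space P"
      have E: "?E \<in> events"
        using r l by (intro sets.finite_INT) (auto intro!: ev)
      have gen: "X (l k) -` B k \<inter> space P \<in> sets (gen_sigma P T (X (l k)))" if "k \<in> {1..r}" for k
        using that B by (intro in_vimage_algebra) auto
      have AE: "AE \<omega> in P. cond_prob_over P F ?E \<omega>
          = (\<Prod>k\<in>{1..r}. cond_prob_over P F (X (l k) -` B k \<inter> space P) \<omega>)"
        using iid[unfolded cond_iid_def cond_indep_def, THEN conjunct1, rule_format, OF r2 l gen]
        by blast
      have "prob ?E = (\<integral>\<omega>. indicator ?E \<omega> \<partial>P)"
        using E by simp
      also have "\<dots> = (\<integral>\<omega>. cond_prob_over P F ?E \<omega> \<partial>P)"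
        using E by (intro real_cond_exp_int(2)[symmetric]) (simp add: emeasure_eq_measure)
      also have "\<dots> = (\<integral>\<omega>. (\<Prod>k\<in>{1..r}. cond_prob_over P F (X (l k) -` B k \<inter> space P) \<omega>) \<partial>P)"
        using AE by (intro integral_cong_AE) auto
      finally show ?thesis .
    qed
    have "AE \<omega> in P. \<forall>k\<in>{1..r}. cond_prob_over P F (X (i k) -` B k \<inter> space P) \<omega>
        = cond_prob_over P F (X (j k) -` B k \<inter> space P) \<omega>"
    proof (intro AE_finite_allI)
      fix k assume k: "k \<in> {1..r}"
      then have ki: "X (i k) -` B k \<inter> space P \<in> events" and kj: "X (j k) -` B k \<inter> space P \<in> events"
        using i j by (auto intro!: ev)
      show "AE \<omega> in P. cond_prob_over P F (X (i k) -` B k \<inter> space P) \<omega>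
          = cond_prob_over P F (X (j k) -` B k \<inter> space P) \<omega>"
      proof (rule real_cond_exp_charact)
        fix A assume A: "A \<in> sets F"
        then have AP: "A \<in> events" using F by (auto simp: subalgebra_def)
        have ind: "(\<integral>\<omega>\<in>A. indicator E \<omega> \<partial>P) = prob (A \<inter> E)" if "E \<in> events" for E
          using that AP unfolding set_lebesgue_integral_def
          by (simp add: indicator_inter_arith[symmetric])
        have "(\<integral>\<omega>\<in>A. indicator (X (i k) -` B k \<inter> space P) \<omega> \<partial>P)
            = (\<integral>\<omega>\<in>A. (indicator (X (j k) -` B k \<inter> space P) \<omega> :: real) \<partial>P)"
          by (simp only: ind ki kj eq[OF A k])
        also have "\<dots> = (\<integral>\<omega>\<in>A. cond_prob_over P F (X (j k) -` B k \<inter> space P) \<omega> \<partial>P)"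
          using kj A by (intro real_cond_exp_intA) (auto simp: emeasure_eq_measure)
        finally show "(\<integral>\<omega>\<in>A. indicator (X (i k) -` B k \<inter> space P) \<omega> \<partial>P)
            = (\<integral>\<omega>\<in>A. cond_prob_over P F (X (j k) -` B k \<inter> space P) \<omega> \<partial>P)" .
      qed (use ki kj in \<open>auto simp: emeasure_eq_measure intro!: real_cond_exp_int\<close>)
    qed simp
    then have "(\<integral>\<omega>. (\<Prod>k\<in>{1..r}. cond_prob_over P F (X (i k) -` B k \<inter> space P) \<omega>) \<partial>P)
        = (\<integral>\<omega>. (\<Prod>k\<in>{1..r}. cond_prob_over P F (X (j k) -` B k \<inter> space P) \<omega>) \<partial>P)"
      by (intro integral_cong_AE) (auto elim!: eventually_mono intro!: prod.cong)
    then show ?thesis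
      by (simp only: int i j)
  qed
qed

lemma exchangeable_imp_distr_eq:
  assumes "exchangeable P T X I" "i \<in> I" "j \<in> I"
  shows "distr P T (X i) = distr P T (X j)"
proof (rule measure_eqI)
  fix B assume "B \<in> sets (distr P T (X i))"
  then have B: "B \<in> sets T" by simp
  have "prob (X i -` B \<inter> space P) = prob (X j -` B \<inter> space P)"
    using assms(1)[unfolded exchangeable_def, rule_format, of "Suc 0" "\<lambda>_. i" "\<lambda>_. j" "\<lambda>_. B"]
      B assms(2,3)
    by (simp add: inj_on_def)
  then show "emeasure (distr P T (X i)) B = emeasure (distr P T (X j)) B"
    using B assms(2,3) random_variable by (simp add: emeasure_distr emeasure_eq_measure)
qed simp

text \<open>On a cylinder the product measure factors, so the joint probability becomes the integral
  of the product of the \<open>Q \<omega>\<close>-masses of the \<open>B k\<close>, an expression in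
  which the indices no longer occur.\<close>

lemma product_kernel_imp_exchangeable:
  assumes Q: "\<And>\<omega>. \<omega> \<in> space P \<Longrightarrow> Q \<omega> \<in> space (prob_algebra T)"
    and F: "subalgebra P F"
    and H: "\<And>H. H \<in> sets (\<Pi>\<^sub>M i\<in>I. T) \<Longrightarrow>
      (\<integral>\<^sup>+\<omega>\<in>space P. emeasure (\<Pi>\<^sub>M i\<in>I. Q \<omega>) H \<partial>(restr_to_subalg P F)) =
      emeasure P (space P \<inter> (\<lambda>\<omega>. \<lambda>i\<in>I. X i \<omega>) -` H)"
  shows "exchangeable P T X I"
proof -
  have rep: "emeasure P (\<Inter>k\<in>{1..r}. X (l k) -` B k \<inter> space P)
      = (\<integral>\<^sup>+\<omega>\<in>space P. (\<Prod>k\<in>{1..r}. emeasure (Q \<omega>) (B k)) \<partial>(restr_to_subalg P F))"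
    if r: "1 \<le> r" and l: "inj_on l {1..r}" "l ` {1..r} \<subseteq> I" and B: "\<forall>k\<in>{1..r}. B k \<in> sets T"
    for r :: nat and l :: "nat \<Rightarrow> 'i" and B
  proof -
    let ?J = "l ` {1..r}"
    define B' where "B' = B \<circ> inv_into {1..r} l"
    have B': "B' (l k) = B k" if "k \<in> {1..r}" for k
      using that l by (simp add: B'_def)
    have B'T: "B' i \<in> sets T" if "i \<in> ?J" for i
      using that B by (auto simp: B')
    let ?H = "prod_emb I (\<lambda>_. T) ?J (\<Pi>\<^sub>E i\<in>?J. B' i)"
    have "space P \<inter> (\<lambda>\<omega>. \<lambda>i\<in>I. X i \<omega>) -` ?H = (\<Inter>k\<in>{1..r}. X (l k) -` B k \<inter> space P)"
      (is "?L = ?R")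
    proof (intro set_eqI iffI)
      fix \<omega> assume "\<omega> \<in> ?L"
      then show "\<omega> \<in> ?R"
        using l(2) by (auto simp: prod_emb_def B' image_subset_iff PiE_iff)
    next
      fix \<omega> assume \<omega>: "\<omega> \<in> ?R"
      then have "\<omega> \<in> space P"
        using r by auto
      with \<omega> show "\<omega> \<in> ?L"
        using l(2) random_variable[THEN measurable_space]
        by (auto simp: prod_emb_def B' image_subset_iff PiE_iff restrict_restrict Int_absorb1)
    qed
    moreover have "?H \<in> sets (\<Pi>\<^sub>M i\<in>I. T)"
      using l B'T by (intro sets_PiM_I) auto
    moreover have emQ: "emeasure (\<Pi>\<^sub>M i\<in>I. Q \<omega>) ?H = (\<Prod>k\<in>{1..r}. emeasure (Q \<omega>) (B k))"
      if "\<omega> \<in> space P" for \<omega>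
    proof -
      interpret Q: prob_space "Q \<omega>"
        using Q[OF that] by (simp add: space_prob_algebra)
      have sQ: "sets (Q \<omega>) = sets T"
        using Q[OF that] by (simp add: space_prob_algebra)
      interpret product_prob_space "\<lambda>_. Q \<omega>" I ..
      have "?H = prod_emb I (\<lambda>_. Q \<omega>) ?J (\<Pi>\<^sub>E i\<in>?J. B' i)"
        using sets_eq_imp_space_eq[OF sQ] by (simp add: prod_emb_def)
      then have "emeasure (\<Pi>\<^sub>M i\<in>I. Q \<omega>) ?H = (\<Prod>i\<in>?J. emeasure (Q \<omega>) (B' i))"
        using l B'T sQ by (simp add: emeasure_PiM_emb)
      also have "\<dots> = (\<Prod>k\<in>{1..r}. emeasure (Q \<omega>) (B k))"
        using l by (simp add: prod.reindex B')
      finally show ?thesis .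
    qed
    ultimately have "emeasure P (\<Inter>k\<in>{1..r}. X (l k) -` B k \<inter> space P)
        = (\<integral>\<^sup>+\<omega>\<in>space P. emeasure (\<Pi>\<^sub>M i\<in>I. Q \<omega>) ?H \<partial>(restr_to_subalg P F))"
      using H[of ?H] by metis
    also have "\<dots> = (\<integral>\<^sup>+\<omega>\<in>space P. (\<Prod>k\<in>{1..r}. emeasure (Q \<omega>) (B k)) \<partial>(restr_to_subalg P F))"
      using emQ by (intro nn_integral_cong) (simp add: space_restr_to_subalg)
    finally show ?thesis .
  qed
  show ?thesis
    unfolding exchangeable_def
  proof (intro allI impI)
    fix r :: nat and i j :: "nat \<Rightarrow> 'i" and B :: "nat \<Rightarrow> 'b set"
    assume *: "1 \<le> r" "inj_on i {1..r}" "i ` {1..r} \<subseteq> I" "inj_on j {1..r}" "j ` {1..r} \<subseteq> I"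
      "\<forall>k\<in>{1..r}. B k \<in> sets T"
    show "prob (\<Inter>k\<in>{1..r}. X (i k) -` B k \<inter> space P)
        = prob (\<Inter>k\<in>{1..r}. X (j k) -` B k \<inter> space P)"
      unfolding measure_def rep[OF *(1-3,6)] rep[OF *(1,4-6)] ..
  qed
qed

end

section \<open>Exchangeability jointly with the tail\<close>

text \<open>Both sides equal S(m + n) - S(m) - S(n), where S denotes partial sums. Moving a window
  of length \<open>n\<close> by \<open>m\<close> places therefore changes only \<open>m\<close>
  terms at each end.\<close>

lemma sum_lessThan_shift:
  fixes a :: "nat \<Rightarrow> real"
  shows "(\<Sum>k<n. a (m + k)) - (\<Sum>k<n. a k) = (\<Sum>k<m. a (n + k)) - (\<Sum>k<m. a k)"
proof -
  have *: "(\<Sum>k<m + n. a k) = (\<Sum>k<m. a k) + (\<Sum>k<n. a (m + k))" for m n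
    by (induction n) (auto simp: algebra_simps)
  show ?thesis
    using *[of m n] *[of n m] by (simp add: add.commute)
qed

context random_family
begin

text \<open>A bijection between \<open>K\<close> and an initial segment frees exchangeability from
  numbering, so that index sets such as a finite \<open>J\<close> joined with a piece of a sequence
  can be used directly.\<close>

lemma exchangeable_integral_hits:
  fixes i j :: "'k \<Rightarrow> 'i"
  assumes ex: "exchangeable P T X I" and K: "finite K" and i: "inj_on i K" "i ` K \<subseteq> I"
    and j: "inj_on j K" "j ` K \<subseteq> I" and B: "\<And>k. k \<in> K \<Longrightarrow> B k \<in> sets T"
  shows "(\<integral>\<omega>. hits (\<lambda>k. X (i k)) K B \<omega> \<partial>P) = (\<integral>\<omega>. hits (\<lambda>k. X (j k)) K B \<omega> \<partial>P)"
proof (cases "K = {}")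
  case True
  then show ?thesis by (simp add: hits_def)
next
  case False
  obtain h n where h: "bij_betw h {1..n} K" and n: "n = card K"
    using ex_bij_betw_nat_finite_1[OF K] by blast
  have h': "inj_on h {1..n}" "h ` {1..n} = K"
    using h by (auto simp: bij_betw_def)
  have card: "1 \<le> n"
    using K n False by (simp add: Suc_le_eq card_gt_0_iff)
  have eq: "(\<integral>\<omega>. hits (\<lambda>k. X (l k)) K B \<omega> \<partial>P)
      = prob (\<Inter>k\<in>{1..n}. X (l (h k)) -` B (h k) \<inter> space P)"
    if l: "l ` K \<subseteq> I" for l
  proof -
    have "(\<integral>\<omega>. hits (\<lambda>k. X (l k)) K B \<omega> \<partial>P) = (\<integral>\<omega>. indicator (space P) \<omega> * hits (\<lambda>k. X (l k)) K B \<omega> \<partial>P)"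
      by (intro Bochner_Integration.integral_cong) auto
    also have "\<dots> = prob (space P \<inter> (\<Inter>k\<in>K. X (l k) -` B k \<inter> space P))"
      using K False l B random_variable by (intro integral_hits_eq_prob[where T=T]) auto
    also have "space P \<inter> (\<Inter>k\<in>K. X (l k) -` B k \<inter> space P) = (\<Inter>k\<in>K. X (l k) -` B k \<inter> space P)"
      using False by auto
    also have "\<dots> = (\<Inter>k\<in>{1..n}. X (l (h k)) -` B (h k) \<inter> space P)"
      unfolding h'(2)[symmetric] by simp
    finally show ?thesis .
  qed
  have "prob (\<Inter>k\<in>{1..n}. X ((i \<circ> h) k) -` (B \<circ> h) k \<inter> space P)
      = prob (\<Inter>k\<in>{1..n}. X ((j \<circ> h) k) -` (B \<circ> h) k \<inter> space P)"
  proof (intro ex[unfolded exchangeable_def, rule_format])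
    show "inj_on (i \<circ> h) {1..n}" "inj_on (j \<circ> h) {1..n}"
      using h' i j by (auto intro: comp_inj_on)
    show "(i \<circ> h) ` {1..n} \<subseteq> I" "(j \<circ> h) ` {1..n} \<subseteq> I"
      using h'(2) i j by (simp_all only: image_comp[symmetric])
    show "(B \<circ> h) k \<in> sets T" if "k \<in> {1..n}" for k
      using that h'(2) B by auto
  qed (rule card)
  then show ?thesis
    unfolding eq[OF i(2)] eq[OF j(2)] by (simp only: comp_def)
qed

end

section \<open>The tail of an injective sequence of indices\<close>

locale exchangeable_sequence = random_family P T X I
  for P :: "'a measure" and T :: "'b measure" and X :: "'i \<Rightarrow> 'a \<Rightarrow> 'b" and I +
  fixes s :: "nat \<Rightarrow> 'i"
  assumes exch: "exchangeable P T X I" and inj_s: "inj s" and s_in: "s k \<in> I"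
begin

text \<open>The tail is taken along \<open>s\<close> alone, although \<open>I\<close> may be
  uncountable: from some point on \<open>s\<close> avoids any given finite set of indices, and this
  is what the replacement arguments use.\<close>

definition tail :: "'a measure" where
  "tail = sigma (space P) (tail_events (\<lambda>k. sets (gen_sigma P T (X (s k)))))"

lemma space_tail [simp]: "space tail = space P"
  by (simp add: tail_def space_measure_of_conv)

lemma sets_tail: "sets tail = tail_events (\<lambda>k. sets (gen_sigma P T (X (s k))))"
proof -
  interpret sigma_algebra "space P" "tail_events (\<lambda>k. sets (gen_sigma P T (X (s k))))"
  proof (rule sigma_algebra_tail_events)
    show "sigma_algebra (space P) (sets (gen_sigma P T (X (s k))))" for k
      using sets.sigma_algebra_axioms[of "gen_sigma P T (X (s k))"] by simp
  qed
  show ?thesis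
    unfolding tail_def by (rule sets_measure_of_eq)
qed

lemma gen_sigma_events: "i \<in> I \<Longrightarrow> sets (gen_sigma P T (X i)) \<subseteq> events"
  using random_variable by (simp add: measurable_iff_sets)

lemma subalgebra_tail: "subalgebra P tail"
  unfolding subalgebra_def sets_tail
  using gen_sigma_events s_in by (auto intro!: tail_events_sets)

sublocale tail: sigma_finite_subalgebra P tail
  by (rule subalgebra_sigma_finite[OF subalgebra_tail])

lemma tail_in_events: "A \<in> sets tail \<Longrightarrow> A \<in> events"
  using subalgebra_tail by (auto simp: subalgebra_def)

lemma measurable_tailD [measurable_dest]: "f \<in> borel_measurable tail \<Longrightarrow> f \<in> borel_measurable P"
  by (rule measurable_from_subalg[OF subalgebra_tail])

text \<open>\<open>tail_events\<close> is an intersection over all \<open>m\<close>, so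
  measurability is checked for the future from each \<open>m\<close> on; the existential leaves the
  choice of the representing space \<open>N\<close> open.\<close>

lemma measurable_tailI:
  fixes f :: "'a \<Rightarrow> real"
  assumes "\<And>m. \<exists>N. space N = space P \<and> f \<in> borel_measurable N \<and>
    sets N = sigma_sets (space P) (\<Union>k\<in>{m..}. sets (gen_sigma P T (X (s k))))"
  shows "f \<in> borel_measurable tail"
proof (rule measurableI)
  fix S :: "real set" assume S: "S \<in> sets borel"
  have "f -` S \<inter> space P \<in> sigma_sets (space P) (\<Union>k\<in>{m..}. sets (gen_sigma P T (X (s k))))" for m
    using assms[of m] S by (metis measurable_sets)
  then show "f -` S \<inter> space tail \<in> sets tail"
    by (simp add: sets_tail tail_events_def)
qed simp

definition seq_from :: "nat \<Rightarrow> 'a \<Rightarrow> nat \<Rightarrow> 'b" where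
  "seq_from m \<omega> = (\<lambda>k\<in>{m..}. X (s k) \<omega>)"

lemma measurable_seq_from [measurable]: "seq_from m \<in> P \<rightarrow>\<^sub>M (\<Pi>\<^sub>M k\<in>{m..}. T)"
  unfolding seq_from_def by (intro measurable_restrict random_variable s_in)

text \<open>The preimages under \<open>seq_from m\<close> form a \<sigma>-algebra that contains all
  generators from \<open>m\<close> on. A tail event thereby becomes a set of sequences, and measures
  on sequences can be compared on cylinders.\<close>

lemma tail_eq_vimage_seq_from:
  assumes "A \<in> sets tail"
  obtains H where "H \<in> sets (\<Pi>\<^sub>M k\<in>{m..}. T)" "A = seq_from m -` H \<inter> space P"
proof -
  let ?V = "vimage_algebra (space P) (seq_from m) (\<Pi>\<^sub>M k\<in>{m..}. T)"
  have "sets (gen_sigma P T (X (s k))) \<subseteq> sets ?V" if "k \<in> {m..}" for k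
  proof -
    have "(\<lambda>\<omega>. seq_from m \<omega> k) \<in> ?V \<rightarrow>\<^sub>M T"
      using measurable_space[OF measurable_seq_from]
      by (intro measurable_compose[OF measurable_vimage_algebra1 measurable_component_singleton[OF that]]) auto
    then have "X (s k) \<in> ?V \<rightarrow>\<^sub>M T"
      using that by (simp add: seq_from_def)
    then show ?thesis
      by (simp add: measurable_iff_sets)
  qed
  then have "(\<Union>k\<in>{m..}. sets (gen_sigma P T (X (s k)))) \<subseteq> sets ?V"
    by blast
  then have "sigma_sets (space P) (\<Union>k\<in>{m..}. sets (gen_sigma P T (X (s k)))) \<subseteq> sets ?V"
    using sets.sigma_sets_subset[of _ ?V] by simp
  moreover have "A \<in> sigma_sets (space P) (\<Union>k\<in>{m..}. sets (gen_sigma P T (X (s k))))"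
    using assms by (simp add: sets_tail tail_events_def)
  ultimately have "A \<in> sets ?V" by blast
  moreover have "seq_from m \<in> space P \<rightarrow> space (\<Pi>\<^sub>M k\<in>{m..}. T)"
    using measurable_space[OF measurable_seq_from] by auto
  from sets_vimage_algebra2[OF this] have "sets ?V = {seq_from m -` H \<inter> space P |H. H \<in> sets (\<Pi>\<^sub>M k\<in>{m..}. T)}" .
  ultimately show ?thesis
    using that by blast
qed

lemma eventually_s_notin: "finite L \<Longrightarrow> \<exists>m. \<forall>k\<ge>m. s k \<notin> L"
proof -
  assume "finite L"
  then have "finite (s -` L)"
    using inj_s by (intro finite_vimageI) auto
  then obtain m where "\<forall>k \<in> s -` L. k < m"
    using finite_nat_set_iff_bounded by blast
  then show ?thesis
    by (meson leD vimageI)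
qed

text \<open>This is exchangeability for the relabelling that sends \<open>i\<close> to
  \<open>j\<close> and fixes all other indices; it prepares the passage from finitely many variables
  of the sequence to tail events.\<close>

lemma integral_hits_replace:
  assumes J: "finite J" "J \<subseteq> I" and i: "i \<in> I - J" and j: "j \<in> I - J" and K: "finite K"
    and sK: "s ` K \<inter> insert i (insert j J) = {}"
    and B0: "B0 \<in> sets T" and B: "\<And>l. l \<in> J \<Longrightarrow> B l \<in> sets T" and C: "\<And>k. k \<in> K \<Longrightarrow> C k \<in> sets T"
  shows "(\<integral>\<omega>. indicator B0 (X i \<omega>) * hits X J B \<omega> * hits (\<lambda>k. X (s k)) K C \<omega> \<partial>P)
    = (\<integral>\<omega>. indicator B0 (X j \<omega>) * hits X J B \<omega> * hits (\<lambda>k. X (s k)) K C \<omega> \<partial>P)"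
proof -
  let ?L = "insert i (J \<union> s ` K)"
  \<comment> \<open>One assignment merges \<open>B0\<close>, \<open>B\<close> and \<open>C\<close>;
    it is consistent because \<open>i\<close>, \<open>J\<close> and the image of \<open>K\<close>
    under \<open>s\<close> are disjoint.\<close>
  define D where "D l = (if l = i then B0 else if l \<in> J then B l else C (inv s l))" for l
  have D: "D i = B0" "\<And>l. l \<in> J \<Longrightarrow> D l = B l" "\<And>k. k \<in> K \<Longrightarrow> D (s k) = C k"
    using i sK inj_s by (auto simp: D_def)
  have inj: "inj_on s K"
    using inj_s by (rule inj_on_subset) simp
  have *: "hits (\<lambda>l. X (g l)) ?L D \<omega>
      = indicator B0 (X (g i) \<omega>) * hits X J B \<omega> * hits (\<lambda>k. X (s k)) K C \<omega>"
    if g: "\<And>l. l \<noteq> i \<Longrightarrow> g l = l" for g \<omega>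
  proof -
    have "hits (\<lambda>l. X (g l)) ?L D \<omega> = indicator (D i) (X (g i) \<omega>) *
        (\<Prod>l\<in>J \<union> s ` K. indicator (D l) (X (g l) \<omega>))"
      unfolding hits_def using i sK J K by (subst prod.insert) auto
    also have "(\<Prod>l\<in>J \<union> s ` K. indicator (D l) (X (g l) \<omega>) :: real)
        = (\<Prod>l\<in>J. indicator (D l) (X (g l) \<omega>)) * (\<Prod>l\<in>s ` K. indicator (D l) (X (g l) \<omega>))"
      using sK J K by (intro prod.union_disjoint) auto
    also have "(\<Prod>l\<in>J. indicator (D l) (X (g l) \<omega>) :: real) = hits X J B \<omega>"
      unfolding hits_def
    proof (intro prod.cong refl)
      fix l assume l: "l \<in> J"
      then have "l \<noteq> i" using i by auto
      then show "indicator (D l) (X (g l) \<omega>) = (indicator (B l) (X l \<omega>) :: real)"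
        by (simp add: D(2)[OF l] g)
    qed
    also have "(\<Prod>l\<in>s ` K. indicator (D l) (X (g l) \<omega>) :: real) = hits (\<lambda>k. X (s k)) K C \<omega>"
      unfolding hits_def prod.reindex[OF inj] comp_def
    proof (intro prod.cong refl)
      fix k assume k: "k \<in> K"
      then have "s k \<noteq> i" using sK by auto
      then show "indicator (D (s k)) (X (g (s k)) \<omega>) = (indicator (C k) (X (s k) \<omega>) :: real)"
        by (simp add: D(3)[OF k] g)
    qed
    finally show ?thesis
      by (simp add: D)
  qed
  \<comment> \<open>A replacement, not a transposition: \<open>j\<close> lies outside
    \<open>?L\<close> unless it equals \<open>i\<close>, so \<open>g\<close> is injective
    there.\<close>
  define g where "g l = (if l = i then j else l)" for l
  have "(\<integral>\<omega>. hits (\<lambda>l. X l) ?L D \<omega> \<partial>P) = (\<integral>\<omega>. hits (\<lambda>l. X (g l)) ?L D \<omega> \<partial>P)"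
  proof (rule exchangeable_integral_hits[OF exch])
    show "inj_on g ?L"
      using i j sK by (auto simp: inj_on_def g_def)
    show "D l \<in> sets T" if "l \<in> ?L" for l
      using that B0 B C D by auto
  qed (use J K i j s_in in \<open>auto simp: g_def\<close>)
  then show ?thesis
    using *[of "\<lambda>l. l"] *[of g] by (simp add: g_def)
qed

text \<open>A tail event depends only on \<open>X (s k)\<close> with \<open>k\<close> beyond all indices in question, so exchangeability
  applies jointly to it and finitely many other variables.\<close>

lemma integral_tail_event_replace:
  assumes A: "A \<in> sets tail" and J: "finite J" "J \<subseteq> I" and i: "i \<in> I - J" and j: "j \<in> I - J"
    and B0: "B0 \<in> sets T" and B: "\<And>l. l \<in> J \<Longrightarrow> B l \<in> sets T"
  shows "(\<integral>\<omega>. indicator A \<omega> * (indicator B0 (X i \<omega>) * hits X J B \<omega>) \<partial>P)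
    = (\<integral>\<omega>. indicator A \<omega> * (indicator B0 (X j \<omega>) * hits X J B \<omega>) \<partial>P)"
proof -
  obtain m where m: "\<And>k. m \<le> k \<Longrightarrow> s k \<notin> insert i (insert j J)"
    using eventually_s_notin[of "insert i (insert j J)"] J by auto
  define u where "u l \<omega> = indicator B0 (X l \<omega>) * hits X J B \<omega>" for l \<omega>
  have hitsJ [measurable]: "hits X J B \<in> borel_measurable P"
    using J B random_variable by (intro measurable_hits[where T=T]) auto
  have u [measurable]: "u l \<in> borel_measurable P" if "l \<in> I" for l
    using B0 random_variable[OF that] unfolding u_def[abs_def] by measurable
  have u0: "0 \<le> u l \<omega>" and u1: "u l \<omega> \<le> 1" for l \<omega>
    using hits_nonneg[of X J B \<omega>] hits_le_1[of X J B \<omega>] by (auto simp: u_def indicator_def)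
  \<comment> \<open>\<open>\<mu> l\<close> is the law of the future of the sequence weighted by
    \<open>u l\<close>, a finite measure. Agreement on cylinders gives
    \<open>\<mu> i = \<mu> j\<close>, hence equal masses for the set of sequences that represents
    \<open>A\<close>.\<close>
  define \<mu> where "\<mu> l = distr (density P (\<lambda>\<omega>. ennreal (u l \<omega>))) (\<Pi>\<^sub>M k\<in>{m..}. T) (seq_from m)" for l
  have em: "emeasure (\<mu> l) H = ennreal (\<integral>\<omega>. indicator (seq_from m -` H \<inter> space P) \<omega> * u l \<omega> \<partial>P)"
    if l: "l \<in> I" and H: "H \<in> sets (\<Pi>\<^sub>M k\<in>{m..}. T)" for l H
  proof -
    have [measurable]: "seq_from m -` H \<inter> space P \<in> events"
      using H by (rule measurable_sets[OF measurable_seq_from])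
    have "emeasure (\<mu> l) H = emeasure (density P (\<lambda>\<omega>. ennreal (u l \<omega>))) (seq_from m -` H \<inter> space P)"
      unfolding \<mu>_def using H by (simp add: emeasure_distr)
    also have "\<dots> = (\<integral>\<^sup>+\<omega>. ennreal (u l \<omega>) * indicator (seq_from m -` H \<inter> space P) \<omega> \<partial>P)"
      using u[OF l] by (intro emeasure_density) auto
    also have "\<dots> = (\<integral>\<^sup>+\<omega>. ennreal (indicator (seq_from m -` H \<inter> space P) \<omega> * u l \<omega>) \<partial>P)"
      by (intro nn_integral_cong) (auto simp: indicator_def)
    also have "\<dots> = ennreal (\<integral>\<omega>. indicator (seq_from m -` H \<inter> space P) \<omega> * u l \<omega> \<partial>P)"
    proof (intro nn_integral_eq_integral integrable_bounded_01)
      show "(\<lambda>\<omega>. indicator (seq_from m -` H \<inter> space P) \<omega> * u l \<omega>) \<in> borel_measurable P"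
        using u[OF l] by measurable
    qed (use u0 u1 in \<open>auto simp: indicator_def\<close>)
    finally show ?thesis .
  qed
  have "\<mu> i = \<mu> j"
  proof (rule measure_eqI_PiM_infinite)
    fix C :: "nat \<Rightarrow> 'b set" and K assume K: "finite K" "K \<subseteq> {m..}" and C: "\<And>k. k \<in> K \<Longrightarrow> C k \<in> sets T"
    let ?H = "prod_emb {m..} (\<lambda>_. T) K (Pi\<^sub>E K C)"
    have "indicator (seq_from m -` ?H \<inter> space P) \<omega> = hits (\<lambda>k. X (s k)) K C \<omega>"
      if \<omega>: "\<omega> \<in> space P" for \<omega>
    proof -
      have "seq_from m \<omega> \<in> space (\<Pi>\<^sub>M k\<in>{m..}. T)"
        using \<omega> measurable_space[OF measurable_seq_from] by blast
      then have "seq_from m \<omega> \<in> ?H \<longleftrightarrow> (\<forall>k\<in>K. X (s k) \<omega> \<in> C k)"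
        using K by (auto simp: prod_emb_def space_PiM PiE_iff seq_from_def)
      then show ?thesis
        using \<omega> K by (auto simp: hits_def indicator_def)
    qed
    then have "emeasure (\<mu> l) ?H = ennreal (\<integral>\<omega>. indicator B0 (X l \<omega>) * hits X J B \<omega> * hits (\<lambda>k. X (s k)) K C \<omega> \<partial>P)"
      if "l \<in> I" for l
      using K C that
      by (subst em) (auto intro!: sets_PiM_I arg_cong[where f=ennreal] Bochner_Integration.integral_cong simp: u_def)
    moreover have "s ` K \<inter> insert i (insert j J) = {}"
      using m K by auto
    note integral_hits_replace[OF J i j K(1) this B0 B C]
    ultimately show "emeasure (\<mu> i) ?H = emeasure (\<mu> j) ?H"
      using i j by simp
  next
    have "emeasure (\<mu> i) (space (\<Pi>\<^sub>M k\<in>{m..}. T)) \<noteq> \<infinity>"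
      using i by (subst em) auto
    then show "finite_measure (\<mu> i)"
      by (intro finite_measureI) (simp add: \<mu>_def)
  qed (simp_all add: \<mu>_def)
  obtain H where H: "H \<in> sets (\<Pi>\<^sub>M k\<in>{m..}. T)" "A = seq_from m -` H \<inter> space P"
    using tail_eq_vimage_seq_from[OF A] by blast
  have "ennreal (\<integral>\<omega>. indicator A \<omega> * u l \<omega> \<partial>P) = emeasure (\<mu> l) H" if "l \<in> I" for l
    using em[OF that H(1)] H(2) by simp
  then have "ennreal (\<integral>\<omega>. indicator A \<omega> * u i \<omega> \<partial>P) = ennreal (\<integral>\<omega>. indicator A \<omega> * u j \<omega> \<partial>P)"
    using \<open>\<mu> i = \<mu> j\<close> i j by simp
  then have "(\<integral>\<omega>. indicator A \<omega> * u i \<omega> \<partial>P) = (\<integral>\<omega>. indicator A \<omega> * u j \<omega> \<partial>P)"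
    using u0 by (subst (asm) ennreal_inj) (auto intro!: integral_nonneg_AE)
  then show ?thesis
    by (simp add: u_def)
qed

text \<open>Agreement on all tail events means that both variables have the same conditional
  expectation given \<open>tail\<close>, from which a bounded tail function can be pulled out. Such
  weights arise in \<open>integral_tail_hits\<close>, where frequencies accumulate in
  \<open>W\<close>.\<close>

lemma integral_tail_replace:
  assumes W: "W \<in> borel_measurable tail" "\<And>\<omega>. 0 \<le> W \<omega>" "\<And>\<omega>. W \<omega> \<le> 1"
    and J: "finite J" "J \<subseteq> I" and i: "i \<in> I - J" and j: "j \<in> I - J"
    and B0: "B0 \<in> sets T" and B: "\<And>l. l \<in> J \<Longrightarrow> B l \<in> sets T"
  shows "(\<integral>\<omega>. W \<omega> * (indicator B0 (X i \<omega>) * hits X J B \<omega>) \<partial>P)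
    = (\<integral>\<omega>. W \<omega> * (indicator B0 (X j \<omega>) * hits X J B \<omega>) \<partial>P)"
proof -
  define u where "u l \<omega> = indicator B0 (X l \<omega>) * hits X J B \<omega>" for l \<omega>
  have hitsJ [measurable]: "hits X J B \<in> borel_measurable P"
    using J B random_variable by (intro measurable_hits[where T=T]) auto
  have u [measurable]: "u l \<in> borel_measurable P" if "l \<in> I" for l
    using B0 random_variable[OF that] unfolding u_def[abs_def] by measurable
  have u0: "0 \<le> u l \<omega>" and u1: "u l \<omega> \<le> 1" for l \<omega>
    using hits_nonneg[of X J B \<omega>] hits_le_1[of X J B \<omega>] by (auto simp: u_def indicator_def)
  have intu: "integrable P (u l)" if "l \<in> I" for l
    using u[OF that] u0 u1 by (rule integrable_bounded_01)
  have intWu: "integrable P (\<lambda>\<omega>. W \<omega> * u l \<omega>)" if "l \<in> I" for l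
    using u[OF that] measurable_tailD[OF W(1)] u0 u1 W by (intro integrable_bounded_01) (auto intro!: mult_le_one)
  have AE: "AE \<omega> in P. real_cond_exp P tail (u i) \<omega> = real_cond_exp P tail (u j) \<omega>"
  proof (rule tail.real_cond_exp_charact)
    fix A assume A: "A \<in> sets tail"
    have "(\<integral>\<omega>\<in>A. u i \<omega> \<partial>P) = (\<integral>\<omega>\<in>A. u j \<omega> \<partial>P)"
      unfolding set_lebesgue_integral_def u_def
      using integral_tail_event_replace[OF A J i j B0 B] by simp
    also have "\<dots> = (\<integral>\<omega>\<in>A. real_cond_exp P tail (u j) \<omega> \<partial>P)"
      using j A intu by (intro tail.real_cond_exp_intA) auto
    finally show "(\<integral>\<omega>\<in>A. u i \<omega> \<partial>P) = (\<integral>\<omega>\<in>A. real_cond_exp P tail (u j) \<omega> \<partial>P)" .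
  qed (use i j intu in \<open>auto intro!: tail.real_cond_exp_int\<close>)
  have "(\<integral>\<omega>. W \<omega> * u l \<omega> \<partial>P) = (\<integral>\<omega>. W \<omega> * real_cond_exp P tail (u l) \<omega> \<partial>P)" if "l \<in> I" for l
    using intWu[OF that] W(1) u[OF that] by (intro tail.real_cond_exp_intg(2)[symmetric])
  moreover have "(\<integral>\<omega>. W \<omega> * real_cond_exp P tail (u i) \<omega> \<partial>P) = (\<integral>\<omega>. W \<omega> * real_cond_exp P tail (u j) \<omega> \<partial>P)"
    using AE measurable_tailD[OF W(1)] by (intro integral_cong_AE) auto
  ultimately show ?thesis
    using i j unfolding u_def by simp
qed

end

section \<open>Limiting frequencies\<close>

context exchangeable_sequence
begin

text \<open>The offset \<open>m\<close> allows the averaged indices to avoid a given finite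
  set.\<close>

definition emp :: "nat \<Rightarrow> nat \<Rightarrow> 'b set \<Rightarrow> 'a \<Rightarrow> real" where
  "emp m n B \<omega> = (\<Sum>k<n. indicator B (X (s (m + k)) \<omega>)) / real n"

text \<open>Along the powers of 4 the empirical means have summable \<open>L\<^sup>1\<close> increments, hence converge almost
  surely; the limit superior makes \<open>freq\<close> monotone in \<open>B\<close> at every \<open>\<omega>\<close>.\<close>

definition freq :: "'b set \<Rightarrow> 'a \<Rightarrow> real" where
  "freq B \<omega> = real_of_ereal (limsup (\<lambda>k. ereal (emp 0 (4 ^ k) B \<omega>)))"

lemma emp_nonneg: "0 \<le> emp m n B \<omega>"
  unfolding emp_def by (intro divide_nonneg_nonneg sum_nonneg) auto

lemma emp_le_1: "emp m n B \<omega> \<le> 1"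
proof -
  have "(\<Sum>k<n. indicator B (X (s (m + k)) \<omega>)) \<le> (\<Sum>k<n. 1::real)"
    by (intro sum_mono) (auto simp: indicator_def)
  then show ?thesis
    unfolding emp_def by (cases "n = 0") (auto simp: divide_le_eq)
qed

lemma measurable_emp [measurable]: "B \<in> sets T \<Longrightarrow> emp m n B \<in> borel_measurable P"
proof -
  assume [measurable]: "B \<in> sets T"
  have [measurable]: "X (s k) \<in> P \<rightarrow>\<^sub>M T" for k
    by (rule random_variable[OF s_in])
  show ?thesis
    unfolding emp_def[abs_def] by measurable
qed

text \<open>When the window moves, \<open>m\<close> terms leave and \<open>m\<close> enter, so means
  over \<open>n\<close> terms differ by at most m / n.\<close>

lemma emp_shift: "(\<lambda>k. emp 0 (4 ^ k) B \<omega> - emp m (4 ^ k) B \<omega>) \<longlonglongrightarrow> 0"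
proof (rule Lim_null_comparison)
  define a where "a k = (indicator B (X (s k) \<omega>) :: real)" for k
  have a: "0 \<le> a k" "a k \<le> 1" for k
    by (auto simp: a_def indicator_def)
  have "\<bar>emp 0 n B \<omega> - emp m n B \<omega>\<bar> \<le> real m / real n" for n
  proof -
    have "emp 0 n B \<omega> - emp m n B \<omega> = - ((\<Sum>k<n. a (m + k)) - (\<Sum>k<n. a k)) / real n"
      by (simp add: emp_def a_def diff_divide_distrib)
    also have "(\<Sum>k<n. a (m + k)) - (\<Sum>k<n. a k) = (\<Sum>k<m. a (n + k) - a k)"
      by (simp add: sum_lessThan_shift sum_subtractf)
    finally have "\<bar>emp 0 n B \<omega> - emp m n B \<omega>\<bar> = \<bar>\<Sum>k<m. a (n + k) - a k\<bar> / real n"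
      by (simp add: abs_divide)
    moreover have "\<bar>\<Sum>k<m. a (n + k) - a k\<bar> \<le> (\<Sum>k<m. 1)"
      using a by (intro order_trans[OF sum_abs] sum_mono) (smt (verit))
    ultimately show ?thesis
      by (simp add: divide_right_mono)
  qed
  from this[of "4 ^ k" for k]
  show "\<forall>\<^sub>F k in sequentially. norm (emp 0 (4 ^ k) B \<omega> - emp m (4 ^ k) B \<omega>) \<le> real m * (1 / 4) ^ k"
    by (simp add: power_divide)
  have "(\<lambda>k. real m * (1 / 4) ^ k) \<longlonglongrightarrow> real m * 0"
    by (intro tendsto_mult tendsto_const LIMSEQ_realpow_zero) auto
  then show "(\<lambda>k. real m * (1 / 4) ^ k) \<longlonglongrightarrow> 0"
    by simp
qed

text \<open>This is what makes \<open>freq\<close> a tail function: by \<open>emp_shift\<close> the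
  starting point of the averages does not affect the limit superior.\<close>

lemma freq_eq_limsup_from: "freq B \<omega> = real_of_ereal (limsup (\<lambda>k. ereal (emp m (4 ^ k) B \<omega>)))"
proof -
  have "(\<lambda>k. ereal (emp 0 (4 ^ k) B \<omega> - emp m (4 ^ k) B \<omega>)) \<longlonglongrightarrow> ereal 0"
    using emp_shift by simp
  from ereal_limsup_lim_add[OF this, of "\<lambda>k. ereal (emp m (4 ^ k) B \<omega>)"]
  show ?thesis
    by (simp add: freq_def)
qed

lemma limsup_emp_bounds:
  "0 \<le> limsup (\<lambda>k. ereal (emp m (4 ^ k) B \<omega>))" "limsup (\<lambda>k. ereal (emp m (4 ^ k) B \<omega>)) \<le> 1"
proof -
  show "0 \<le> limsup (\<lambda>k. ereal (emp m (4 ^ k) B \<omega>))"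
    using emp_nonneg by (intro le_Limsup) (auto simp: always_eventually)
  show "limsup (\<lambda>k. ereal (emp m (4 ^ k) B \<omega>)) \<le> 1"
    using emp_le_1 by (intro Limsup_bounded) (auto simp: always_eventually)
qed

lemma freq_nonneg: "0 \<le> freq B \<omega>"
  unfolding freq_def using limsup_emp_bounds by (intro real_of_ereal_pos)

lemma freq_le_1: "freq B \<omega> \<le> 1"
  unfolding freq_def using real_of_ereal_positive_mono[OF limsup_emp_bounds] by simp

lemma freq_mono:
  assumes "B \<subseteq> C"
  shows "freq B \<omega> \<le> freq C \<omega>"
  unfolding freq_def
proof (rule real_of_ereal_positive_mono)
  show "limsup (\<lambda>k. ereal (emp 0 (4 ^ k) B \<omega>)) \<le> limsup (\<lambda>k. ereal (emp 0 (4 ^ k) C \<omega>))"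
    using assms unfolding emp_def
    by (intro Limsup_mono always_eventually allI)
       (auto intro!: divide_right_mono sum_mono split: split_indicator)
  show "limsup (\<lambda>k. ereal (emp 0 (4 ^ k) C \<omega>)) \<noteq> \<infinity>"
    using limsup_emp_bounds(2)[of 0 C \<omega>] by auto
qed (rule limsup_emp_bounds)

lemma measurable_freq: "B \<in> sets T \<Longrightarrow> freq B \<in> borel_measurable tail"
proof (rule measurable_tailI)
  fix m assume B: "B \<in> sets T"
  let ?S = "\<Union>k\<in>{m..}. sets (gen_sigma P T (X (s k)))"
  let ?N = "sigma (space P) ?S"
  have S: "?S \<subseteq> Pow (space P)"
    using sets.sets_into_space by fastforce
  have "(\<lambda>\<omega>. indicator B (X (s (m + k)) \<omega>) :: real) \<in> borel_measurable ?N" for k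
  proof -
    have "X (s (m + k)) -` B \<inter> space P \<in> sets (gen_sigma P T (X (s (m + k))))"
      using B by (rule in_vimage_algebra)
    then have "X (s (m + k)) -` B \<inter> space P \<in> sets ?N"
      using S by (auto intro!: sigma_sets.Basic bexI[of _ "m + k"])
    then have "(indicator (X (s (m + k)) -` B \<inter> space P) :: 'a \<Rightarrow> real) \<in> borel_measurable ?N"
      by (rule borel_measurable_indicator)
    then show ?thesis
      by (rule measurable_cong[THEN iffD1, rotated]) (auto simp: indicator_def space_measure_of_conv)
  qed
  then have "emp m n B \<in> borel_measurable ?N" for n
    unfolding emp_def[abs_def] by measurable
  then have "freq B \<in> borel_measurable ?N"
    unfolding freq_eq_limsup_from[of B _ m, abs_def] by measurable
  then show "\<exists>N. space N = space P \<and> freq B \<in> borel_measurable N \<and> sets N = sigma_sets (space P) ?S"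
    using S by (intro exI[of _ ?N]) (simp add: space_measure_of_conv)
qed

section \<open>Second moments and almost sure convergence of the averages\<close>

text \<open>Of the n * m pairs of indices exactly n are diagonal, because n \<le> m. By
  exchangeability each diagonal pair contributes one constant p and each other pair one constant c,
  so the mean is c + (p - c) / m. As only the larger window enters, a squared increment has mean (p
  - c) (1 / n - 1 / m).\<close>

lemma integral_emp_mult_emp:
  assumes B: "B \<in> sets T" and nm: "0 < n" "n \<le> m"
  shows "(\<integral>\<omega>. emp 0 n B \<omega> * emp 0 m B \<omega> \<partial>P)
    = prob (X (s 0) -` B \<inter> X (s 1) -` B \<inter> space P)
      + (prob (X (s 0) -` B \<inter> space P) - prob (X (s 0) -` B \<inter> X (s 1) -` B \<inter> space P)) / real m"
proof -
  define a where "a k \<omega> = (indicator B (X (s k) \<omega>) :: real)" for k \<omega>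
  define p where "p = prob (X (s 0) -` B \<inter> space P)"
  define c where "c = prob (X (s 0) -` B \<inter> X (s 1) -` B \<inter> space P)"
  have Xs [measurable]: "X (s k) \<in> P \<rightarrow>\<^sub>M T" for k
    by (rule random_variable[OF s_in])
  have [measurable]: "a k \<in> borel_measurable P" for k
    using B unfolding a_def[abs_def] by measurable
  have int: "integrable P (\<lambda>\<omega>. a k \<omega> * a l \<omega>)" for k l
  proof (intro integrable_bounded_01)
    show "(\<lambda>\<omega>. a k \<omega> * a l \<omega>) \<in> borel_measurable P" by measurable
  qed (auto simp: a_def indicator_def)
  have aa: "(\<integral>\<omega>. a k \<omega> * a l \<omega> \<partial>P) = (if k = l then p else c)" for k l
  proof (cases "k = l")
    case True
    have "(\<integral>\<omega>. a k \<omega> * a l \<omega> \<partial>P) = (\<integral>\<omega>. hits (\<lambda>i. X (s i)) {k} (\<lambda>_. B) \<omega> \<partial>P)"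
      by (intro Bochner_Integration.integral_cong) (auto simp: True hits_def a_def indicator_def)
    also have "\<dots> = (\<integral>\<omega>. hits (\<lambda>i. X (s 0)) {k} (\<lambda>_. B) \<omega> \<partial>P)"
      using B s_in by (intro exchangeable_integral_hits[OF exch]) auto
    also have "\<dots> = (\<integral>\<omega>. indicator (space P) \<omega> * hits (\<lambda>i. X (s 0)) {k} (\<lambda>_. B) \<omega> \<partial>P)"
      by (intro Bochner_Integration.integral_cong) auto
    also have "\<dots> = p"
      using B by (subst integral_hits_eq_prob[where T=T]) (auto simp: p_def Int_absorb1)
    finally show ?thesis using True by simp
  next
    case False
    \<comment> \<open>Relabels two distinct positions as 0 and 1, the pair in terms of which
      \<open>c\<close> is defined.\<close>
    define t where "t i = (if i = k then 0 else 1::nat)" for i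
    have "(\<integral>\<omega>. a k \<omega> * a l \<omega> \<partial>P) = (\<integral>\<omega>. hits (\<lambda>i. X (s i)) {k, l} (\<lambda>_. B) \<omega> \<partial>P)"
      using False by (intro Bochner_Integration.integral_cong) (auto simp: hits_def a_def)
    also have "\<dots> = (\<integral>\<omega>. hits (\<lambda>i. X (s (t i))) {k, l} (\<lambda>_. B) \<omega> \<partial>P)"
      using B s_in False
      by (intro exchangeable_integral_hits[OF exch]) (auto simp: t_def inj_on_def inj_eq[OF inj_s])
    also have "\<dots> = (\<integral>\<omega>. indicator (space P) \<omega> * hits (\<lambda>i. X (s (t i))) {k, l} (\<lambda>_. B) \<omega> \<partial>P)"
      by (intro Bochner_Integration.integral_cong) auto
    also have "\<dots> = prob (space P \<inter> (\<Inter>i\<in>{k, l}. X (s (t i)) -` B \<inter> space P))"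
      using B by (intro integral_hits_eq_prob[where T=T]) auto
    also have "space P \<inter> (\<Inter>i\<in>{k, l}. X (s (t i)) -` B \<inter> space P) = X (s 0) -` B \<inter> X (s 1) -` B \<inter> space P"
      using False by (auto simp: t_def)
    finally show ?thesis using False by (simp add: c_def)
  qed
  have "(\<integral>\<omega>. emp 0 n B \<omega> * emp 0 m B \<omega> \<partial>P)
      = (\<integral>\<omega>. (\<Sum>k<n. \<Sum>l<m. a k \<omega> * a l \<omega>) / (real n * real m) \<partial>P)"
    by (intro Bochner_Integration.integral_cong) (auto simp: emp_def a_def sum_product)
  also have "\<dots> = (\<Sum>k<n. \<Sum>l<m. (if k = l then p else c)) / (real n * real m)"
    using int by (simp add: aa Bochner_Integration.integrable_sum)
  also have "(\<Sum>k<n. \<Sum>l<m. (if k = l then p else c)) = (\<Sum>k<n. real m * c + (p - c))"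
  proof (intro sum.cong refl)
    fix k assume "k \<in> {..<n}"
    then have k: "k < m" using nm by simp
    have "(\<Sum>l<m. (if k = l then p else c)) = (\<Sum>l<m. c + (if k = l then p - c else 0))"
      by (intro sum.cong) auto
    also have "\<dots> = real m * c + (p - c)"
      using k by (simp add: sum.distrib)
    finally show "(\<Sum>l<m. (if k = l then p else c)) = real m * c + (p - c)" .
  qed
  also have "(\<Sum>k<n. real m * c + (p - c)) / (real n * real m) = c + (p - c) / real m"
    using nm by (simp add: field_simps)
  finally show ?thesis
    by (simp add: p_def c_def)
qed

lemma integral_abs_emp_diff:
  assumes B: "B \<in> sets T"
  shows "(\<integral>\<omega>. \<bar>emp 0 (4 ^ Suc k) B \<omega> - emp 0 (4 ^ k) B \<omega>\<bar> \<partial>P) \<le> (1 / 2) ^ k"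
proof -
  define d where "d \<omega> = emp 0 (4 ^ Suc k) B \<omega> - emp 0 (4 ^ k) B \<omega>" for \<omega>
  define p where "p = prob (X (s 0) -` B \<inter> space P)"
  define c where "c = prob (X (s 0) -` B \<inter> X (s 1) -` B \<inter> space P)"
  note [measurable] = measurable_emp[OF B]
  have int: "integrable P (\<lambda>\<omega>. emp 0 n B \<omega> * emp 0 m B \<omega>)" for n m
    using emp_nonneg emp_le_1 by (intro integrable_bounded_01) (auto intro!: mult_le_one)
  have d2: "(d \<omega>)\<^sup>2 = emp 0 (4 ^ Suc k) B \<omega> * emp 0 (4 ^ Suc k) B \<omega> + emp 0 (4 ^ k) B \<omega> * emp 0 (4 ^ k) B \<omega>
      - 2 * (emp 0 (4 ^ k) B \<omega> * emp 0 (4 ^ Suc k) B \<omega>)" for \<omega>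
    unfolding d_def by (simp add: power2_eq_square algebra_simps)
  have int2: "integrable P (\<lambda>\<omega>. (d \<omega>)\<^sup>2)"
    unfolding d2 by (intro Bochner_Integration.integrable_diff Bochner_Integration.integrable_add
        integrable_mult_right int)
  have "(\<integral>\<omega>. (d \<omega>)\<^sup>2 \<partial>P) = (p - c) / 4 ^ k - (p - c) / 4 ^ Suc k"
    unfolding d2 using int
    by (subst Bochner_Integration.integral_diff Bochner_Integration.integral_add,
        (intro Bochner_Integration.integrable_add integrable_mult_right int)+)
       (simp add: Bochner_Integration.integral_add integral_emp_mult_emp[OF B] p_def c_def
          del: power_Suc)
  also have "\<dots> \<le> (p - c) / 4 ^ k"
  proof -
    have "c \<le> p"
      unfolding p_def c_def using B random_variable[OF s_in]
      by (intro finite_measure_mono) (auto intro: measurable_sets)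
    then have "0 \<le> (p - c) / 4 ^ Suc k" by simp
    then show ?thesis by linarith
  qed
  also have "\<dots> \<le> 1 / 4 ^ k"
  proof -
    have "p \<le> 1" "0 \<le> c" by (simp_all add: p_def c_def)
    then show ?thesis by (intro divide_right_mono) auto
  qed
  finally have Ed2: "(\<integral>\<omega>. (d \<omega>)\<^sup>2 \<partial>P) \<le> 1 / 4 ^ k" .
  \<comment> \<open>Expansion of 2^k (|x| - 2^-k)^2 \<ge> 0, used in place of Cauchy-Schwarz. The
    weight 2^k balances the two terms when the mean of x^2 is about 4^-k.\<close>
  have AMGM: "\<bar>x\<bar> \<le> (2 ^ k * x\<^sup>2 + (1 / 2) ^ k) / 2" for x :: real
  proof -
    have "0 \<le> 2 ^ k * (\<bar>x\<bar> - (1 / 2) ^ k)\<^sup>2"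
      by simp
    also have "\<dots> = 2 ^ k * x\<^sup>2 + (1 / 2) ^ k - 2 * \<bar>x\<bar>"
      by (simp add: power2_eq_square field_simps power_divide power_mult_distrib[symmetric])
    finally show ?thesis by simp
  qed
  have "(\<integral>\<omega>. \<bar>d \<omega>\<bar> \<partial>P) \<le> (\<integral>\<omega>. (2 ^ k * (d \<omega>)\<^sup>2 + (1 / 2) ^ k) / 2 \<partial>P)"
  proof (intro integral_mono AMGM)
    have "\<bar>d \<omega>\<bar> \<le> 1" for \<omega>
      using emp_nonneg[of 0 "4 ^ k" B \<omega>] emp_le_1[of 0 "4 ^ k" B \<omega>]
        emp_nonneg[of 0 "4 ^ Suc k" B \<omega>] emp_le_1[of 0 "4 ^ Suc k" B \<omega>]
      unfolding d_def by linarith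
    then show "integrable P (\<lambda>\<omega>. \<bar>d \<omega>\<bar>)"
      by (intro integrable_bounded_01) (auto simp: d_def[abs_def])
  qed (use int2 in simp)
  also have "\<dots> = (2 ^ k * (\<integral>\<omega>. (d \<omega>)\<^sup>2 \<partial>P) + (1 / 2) ^ k) / 2"
    using int2 by (simp add: prob_space)
  also have "\<dots> \<le> (2 ^ k * (1 / 4 ^ k) + (1 / 2) ^ k) / 2"
    using Ed2 by (intro divide_right_mono add_mono mult_left_mono) auto
  also have "2 ^ k * (1 / 4 ^ k) = ((1 / 2) ^ k :: real)"
    by (simp add: power_divide[symmetric])
  finally show ?thesis
    by (simp add: d_def)
qed

text \<open>The first moments of the increments are bounded by a geometric series, so the increments
  are absolutely summable almost surely and the limit superior is a limit. One null set serves all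
  \<open>m\<close> because \<open>emp_shift\<close> holds at every \<omega>.\<close>

lemma AE_emp_tendsto_freq:
  assumes B: "B \<in> sets T"
  shows "AE \<omega> in P. \<forall>m. (\<lambda>k. emp m (4 ^ k) B \<omega>) \<longlonglongrightarrow> freq B \<omega>"
proof -
  note [measurable] = measurable_emp[OF B]
  define d where "d k \<omega> = emp 0 (4 ^ Suc k) B \<omega> - emp 0 (4 ^ k) B \<omega>" for k \<omega>
  have [measurable]: "d k \<in> borel_measurable P" for k
    unfolding d_def[abs_def] by measurable
  have "(\<integral>\<^sup>+\<omega>. ennreal \<bar>d k \<omega>\<bar> \<partial>P) \<le> ennreal ((1 / 2) ^ k)" for k
  proof -
    have "\<bar>d k \<omega>\<bar> \<le> 1" for \<omega>
      using emp_nonneg[of 0 "4 ^ k" B \<omega>] emp_le_1[of 0 "4 ^ k" B \<omega>]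
        emp_nonneg[of 0 "4 ^ Suc k" B \<omega>] emp_le_1[of 0 "4 ^ Suc k" B \<omega>]
      unfolding d_def by linarith
    then have "integrable P (\<lambda>\<omega>. \<bar>d k \<omega>\<bar>)"
      by (intro integrable_bounded_01) auto
    then have "(\<integral>\<^sup>+\<omega>. ennreal \<bar>d k \<omega>\<bar> \<partial>P) = ennreal (\<integral>\<omega>. \<bar>d k \<omega>\<bar> \<partial>P)"
      by (intro nn_integral_eq_integral) auto
    also have "\<dots> \<le> ennreal ((1 / 2) ^ k)"
      using integral_abs_emp_diff[OF B, of k] by (intro ennreal_leI) (simp add: d_def)
    finally show ?thesis .
  qed
  then have "(\<integral>\<^sup>+\<omega>. (\<Sum>k. ennreal \<bar>d k \<omega>\<bar>) \<partial>P) \<le> (\<Sum>k. ennreal ((1 / 2) ^ k))"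
    by (subst nn_integral_suminf) (auto intro!: suminf_le)
  also have "(\<Sum>k. ennreal ((1 / 2) ^ k)) = ennreal (\<Sum>k. (1 / 2) ^ k)"
    by (intro suminf_ennreal2 summable_geometric) auto
  also have "\<dots> < \<infinity>" by simp
  finally have "AE \<omega> in P. (\<Sum>k. ennreal \<bar>d k \<omega>\<bar>) \<noteq> \<infinity>"
    by (intro nn_integral_PInf_AE) auto
  then show ?thesis
  proof eventually_elim
    case (elim \<omega>)
    have "summable (\<lambda>k. \<bar>d k \<omega>\<bar>)"
      using elim by (intro summable_suminf_not_top) auto
    then have "summable (\<lambda>k. d k \<omega>)"
      by (rule summable_rabs_cancel)
    then have "(\<lambda>n. \<Sum>k<n. d k \<omega>) \<longlonglongrightarrow> (\<Sum>k. d k \<omega>)"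
      by (rule summable_LIMSEQ)
    also have "(\<lambda>n. \<Sum>k<n. d k \<omega>) = (\<lambda>n. emp 0 (4 ^ n) B \<omega> - emp 0 (4 ^ 0) B \<omega>)"
      unfolding d_def using sum_lessThan_telescope[of "\<lambda>k. emp 0 (4 ^ k) B \<omega>"] by simp
    finally obtain L where L: "(\<lambda>k. emp 0 (4 ^ k) B \<omega>) \<longlonglongrightarrow> L"
      using LIM_zero_cancel by (metis convergent_def convergent_diff_const_right_iff)
    then have "(\<lambda>k. ereal (emp 0 (4 ^ k) B \<omega>)) \<longlonglongrightarrow> ereal L"
      by simp
    then have "freq B \<omega> = L"
      unfolding freq_def by (subst lim_imp_Limsup) auto
    moreover have "(\<lambda>k. emp m (4 ^ k) B \<omega>) \<longlonglongrightarrow> L" for m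
      using tendsto_diff[OF L emp_shift[of B \<omega> m]] by simp
    ultimately show ?case by simp
  qed
qed

text \<open>Induction on \<open>J\<close> with \<open>W\<close> arbitrary: once the factor at
  \<open>i\<close> has become \<open>freq (B i)\<close>, it is a tail function and joins the weight
  for the remaining indices.\<close>

lemma integral_tail_hits:
  assumes "finite J" "J \<subseteq> I" "\<And>l. l \<in> J \<Longrightarrow> B l \<in> sets T"
    and "W \<in> borel_measurable tail" "\<And>\<omega>. 0 \<le> W \<omega>" "\<And>\<omega>. W \<omega> \<le> 1"
  shows "(\<integral>\<omega>. W \<omega> * hits X J B \<omega> \<partial>P) = (\<integral>\<omega>. W \<omega> * (\<Prod>i\<in>J. freq (B i) \<omega>) \<partial>P)"
  using assms
proof (induction J arbitrary: W)
  case empty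
  then show ?case by (simp add: hits_def)
next
  case (insert i J)
  then have Bi: "B i \<in> sets T" and BJ: "\<And>l. l \<in> J \<Longrightarrow> B l \<in> sets T" and iI: "i \<in> I - J" and JI: "J \<subseteq> I"
    by auto
  note W = insert.prems(3,4,5)
  \<comment> \<open>Averaging starts beyond \<open>J\<close>, so that every averaged index may stand
    in for \<open>i\<close>.\<close>
  obtain m where m: "\<And>k. m \<le> k \<Longrightarrow> s k \<notin> J"
    using eventually_s_notin[OF \<open>finite J\<close>] by auto
  have [measurable]: "hits X J B \<in> borel_measurable P"
    using JI BJ random_variable by (intro measurable_hits[where T=T]) auto
  note [measurable] = measurable_tailD[OF W(1)] measurable_emp[OF Bi] measurable_tailD[OF measurable_freq[OF Bi]]
  have Xs [measurable]: "X (s k) \<in> P \<rightarrow>\<^sub>M T" for k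
    by (rule random_variable[OF s_in])
  let ?a = "\<integral>\<omega>. W \<omega> * hits X (insert i J) B \<omega> \<partial>P"
  have a: "?a = (\<integral>\<omega>. W \<omega> * (indicator (B i) (X i \<omega>) * hits X J B \<omega>) \<partial>P)"
    using insert.hyps by (simp add: hits_def)
  have avg: "(\<integral>\<omega>. W \<omega> * emp m n (B i) \<omega> * hits X J B \<omega> \<partial>P) = ?a" if "0 < n" for n
  proof -
    have int: "integrable P (\<lambda>\<omega>. W \<omega> * (indicator (B i) (X (s k) \<omega>) * hits X J B \<omega>))" for k
      using W hits_nonneg[of X J B] hits_le_1[of X J B] Bi
      by (intro integrable_bounded_01) (auto intro!: mult_le_one)
    have "(\<integral>\<omega>. W \<omega> * emp m n (B i) \<omega> * hits X J B \<omega> \<partial>P)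
        = (\<integral>\<omega>. (\<Sum>k<n. W \<omega> * (indicator (B i) (X (s (m + k)) \<omega>) * hits X J B \<omega>)) / real n \<partial>P)"
      by (intro Bochner_Integration.integral_cong)
         (auto simp: emp_def sum_distrib_left sum_distrib_right sum_divide_distrib mult_ac)
    also have "\<dots> = (\<Sum>k<n. \<integral>\<omega>. W \<omega> * (indicator (B i) (X (s (m + k)) \<omega>) * hits X J B \<omega>) \<partial>P) / real n"
      using int by (simp add: Bochner_Integration.integral_sum)
    also have "\<dots> = (\<Sum>k<n. ?a) / real n"
    proof -
      have "s (m + k) \<in> I - J" for k
        using m[of "m + k"] s_in by auto
      from integral_tail_replace[OF W insert.hyps(1) JI iI this Bi BJ]
      show ?thesis unfolding a by simp
    qed
    finally show ?thesis using that by simp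
  qed
  \<comment> \<open>The averaged integrals are constant in \<open>k\<close>, and by dominated
    convergence they also tend to the integral with \<open>freq (B i)\<close>.\<close>
  have "(\<lambda>k. \<integral>\<omega>. W \<omega> * emp m (4 ^ k) (B i) \<omega> * hits X J B \<omega> \<partial>P) \<longlonglongrightarrow> ?a"
    by (subst avg) auto
  moreover have "(\<lambda>k. \<integral>\<omega>. W \<omega> * emp m (4 ^ k) (B i) \<omega> * hits X J B \<omega> \<partial>P)
      \<longlonglongrightarrow> (\<integral>\<omega>. W \<omega> * freq (B i) \<omega> * hits X J B \<omega> \<partial>P)"
  proof (rule integral_dominated_convergence[where w="\<lambda>_. 1"])
    show "AE \<omega> in P. (\<lambda>k. W \<omega> * emp m (4 ^ k) (B i) \<omega> * hits X J B \<omega>)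
        \<longlonglongrightarrow> W \<omega> * freq (B i) \<omega> * hits X J B \<omega>"
      using AE_emp_tendsto_freq[OF Bi] by eventually_elim (auto intro!: tendsto_intros)
    show "AE \<omega> in P. norm (W \<omega> * emp m (4 ^ k) (B i) \<omega> * hits X J B \<omega>) \<le> 1" for k
      using W hits_nonneg[of X J B] hits_le_1[of X J B] emp_nonneg emp_le_1
      by (auto simp: abs_mult intro!: mult_le_one)
  qed auto
  ultimately have "?a = (\<integral>\<omega>. W \<omega> * freq (B i) \<omega> * hits X J B \<omega> \<partial>P)"
    by (rule LIMSEQ_unique)
  also have "\<dots> = (\<integral>\<omega>. W \<omega> * freq (B i) \<omega> * (\<Prod>j\<in>J. freq (B j) \<omega>) \<partial>P)"
    using W measurable_freq[OF Bi] freq_nonneg freq_le_1 BJ JI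
    by (intro insert.IH) (auto intro!: mult_le_one)
  also have "\<dots> = (\<integral>\<omega>. W \<omega> * (\<Prod>j\<in>insert i J. freq (B j) \<omega>) \<partial>P)"
    using insert.hyps by (simp add: mult.assoc)
  finally show ?case .
qed

lemma directed_by_tail_freq: "directed_by tail freq"
  unfolding directed_by_def
proof (intro conjI ballI allI impI)
  fix A J and B :: "'i \<Rightarrow> 'b set"
  assume A: "A \<in> sets tail" and *: "finite J" "J \<subseteq> I" "\<forall>i\<in>J. B i \<in> sets T"
  show "(\<integral>\<omega>. indicator A \<omega> * hits X J B \<omega> \<partial>P) = (\<integral>\<omega>. indicator A \<omega> * (\<Prod>i\<in>J. freq (B i) \<omega>) \<partial>P)"
    using * A by (intro integral_tail_hits) auto
qed (auto simp: subalgebra_tail measurable_freq freq_nonneg freq_le_1)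

end

section \<open>Countably generated sigma-algebras\<close>

text \<open>\<open>ternary_tail\<close> removes leading ternary digits, all 0 or 2 on the Cantor set; it recovers a sequence
  from its \<open>cantor\<close> code in a Borel way.\<close>

fun ternary_tail :: "nat \<Rightarrow> real \<Rightarrow> real" where
  "ternary_tail 0 x = x"
| "ternary_tail (Suc n) x = 3 * ternary_tail n x - (if ternary_tail n x > 1 / 2 then 2 else 0)"

lemma measurable_ternary_tail [measurable]: "ternary_tail n \<in> borel_measurable borel"
proof (induction n)
  case (Suc n)
  note [measurable] = Suc
  show ?case unfolding ternary_tail.simps(2)[abs_def] by measurable
qed (simp add: ternary_tail.simps(1)[abs_def])

text \<open>A leading digit 0 puts the value in [0, 1/3] and a leading digit 2 in [2/3, 1], so
  comparison with 1/2 reads the digit unambiguously. Binary digits would give some points two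
  codes.\<close>

definition cantor :: "(nat \<Rightarrow> bool) \<Rightarrow> real" where
  "cantor b = (\<Sum>n. of_bool (b n) * (2 / 3) * (1 / 3) ^ n)"

lemma sums_two_thirds: "(\<lambda>n. (2 / 3) * (1 / 3) ^ n) sums (1::real)"
  using sums_mult[OF geometric_sums[of "1/3::real"], of "2/3"] by simp

lemma summable_cantor: "summable (\<lambda>n. of_bool (b n) * (2 / 3) * (1 / 3) ^ n :: real)"
  by (rule summable_comparison_test'[OF sums_summable[OF sums_two_thirds], of 0]) auto

lemma cantor_nonneg: "0 \<le> cantor b"
  unfolding cantor_def by (intro suminf_nonneg summable_cantor) auto

lemma cantor_le_1: "cantor b \<le> 1"
proof -
  have "cantor b \<le> (\<Sum>n. (2 / 3) * (1 / 3) ^ n)"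
    unfolding cantor_def
    by (intro suminf_le summable_cantor sums_summable[OF sums_two_thirds]) auto
  then show ?thesis
    using sums_unique[OF sums_two_thirds] by simp
qed

lemma cantor_Suc: "cantor b = (2 / 3) * of_bool (b 0) + cantor (\<lambda>n. b (Suc n)) / 3"
proof -
  have "cantor b = (\<Sum>n. of_bool (b (Suc n)) * (2 / 3) * (1 / 3) ^ Suc n) + of_bool (b 0) * (2 / 3)"
    unfolding cantor_def using suminf_split_head[OF summable_cantor[of b]] by simp
  also have "(\<Sum>n. of_bool (b (Suc n)) * (2 / 3) * (1 / 3) ^ Suc n) = cantor (\<lambda>n. b (Suc n)) / 3"
    unfolding cantor_def using suminf_divide[OF summable_cantor[of "\<lambda>n. b (Suc n)"], of 3] by simp
  finally show ?thesis by simp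
qed

lemma cantor_gt_half: "cantor b > 1 / 2 \<longleftrightarrow> b 0"
  using cantor_Suc[of b] cantor_nonneg[of "\<lambda>n. b (Suc n)"] cantor_le_1[of "\<lambda>n. b (Suc n)"]
  by (cases "b 0") auto

lemma ternary_tail_cantor: "ternary_tail n (cantor b) = cantor (\<lambda>k. b (n + k))"
proof (induction n)
  case (Suc n)
  show ?case
    unfolding ternary_tail.simps Suc.IH cantor_gt_half
    using cantor_Suc[of "\<lambda>k. b (n + k)"] by simp
qed simp

text \<open>\<open>f\<close> is the Marczewski function of an enumeration of \<open>C\<close>:
  membership in the generators supplies its ternary digits. It is measurable as a series of
  indicators, and conversely each digit is a Borel condition on its value, so the two
  \<sigma>-algebras coincide.\<close>

lemma countably_generated_imp_real_map:
  assumes C: "countable C" "C \<subseteq> Pow \<Omega>"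
  obtains f :: "'b \<Rightarrow> real" where "\<And>y. 0 \<le> f y" "\<And>y. f y \<le> 1"
    "sigma_sets \<Omega> C = {f -` S \<inter> \<Omega> |S. S \<in> sets borel}"
proof -
  \<comment> \<open>Inserting the empty set gives something to enumerate even if \<open>C\<close> is
    empty, and leaves the generated \<sigma>-algebra unchanged.\<close>
  define c where "c = from_nat_into (insert {} C)"
  have c: "range c = insert {} C"
    unfolding c_def using C by (intro range_from_nat_into) auto
  define f where "f y = cantor (\<lambda>n. y \<in> c n)" for y
  have decode: "y \<in> c n \<longleftrightarrow> ternary_tail n (f y) > 1 / 2" for y n
    unfolding f_def ternary_tail_cantor cantor_gt_half by simp
  let ?M = "sigma \<Omega> C"
  have cM [measurable]: "c n \<in> sets ?M" for n
  proof -
    have "c n \<in> insert {} C" using c by blast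
    then show ?thesis using C by (auto intro: sigma_sets.Empty)
  qed
  have f: "f \<in> borel_measurable ?M"
  proof -
    have "(\<lambda>y. of_bool (y \<in> c n) :: real) \<in> borel_measurable ?M" for n
    proof -
      have "(\<lambda>y. of_bool (y \<in> c n) :: real) = indicator (c n)"
        by (auto simp: indicator_def)
      then show ?thesis by simp
    qed
    then show ?thesis
      unfolding f_def[abs_def] cantor_def by measurable
  qed
  have "sigma_sets \<Omega> C = sets (vimage_algebra \<Omega> f borel)"
  proof
    have "c n \<inter> \<Omega> \<in> sets (vimage_algebra \<Omega> f borel)" for n
    proof -
      have "{x. ternary_tail n x > 1 / 2} \<in> sets borel" by measurable
      from in_vimage_algebra[OF this, of f \<Omega>] show ?thesis
        by (simp add: decode vimage_def Int_def)
    qed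
    then have "C \<subseteq> sets (vimage_algebra \<Omega> f borel)"
    proof (intro subsetI)
      fix x assume *: "\<And>n. c n \<inter> \<Omega> \<in> sets (vimage_algebra \<Omega> f borel)" and x: "x \<in> C"
      then obtain n where "x = c n" using c by (metis insertCI rangeE)
      then show "x \<in> sets (vimage_algebra \<Omega> f borel)"
        using *[of n] x C by (simp add: Int_absorb2 subset_iff)
    qed
    then show "sigma_sets \<Omega> C \<subseteq> sets (vimage_algebra \<Omega> f borel)"
      using sets.sigma_sets_subset[of C "vimage_algebra \<Omega> f borel"] by simp
    show "sets (vimage_algebra \<Omega> f borel) \<subseteq> sigma_sets \<Omega> C"
      using f C by (simp add: measurable_iff_sets space_measure_of_conv)
  qed
  also have "\<dots> = {f -` S \<inter> \<Omega> |S. S \<in> sets borel}"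
    by (intro sets_vimage_algebra2) auto
  finally show ?thesis
    using that[of f] cantor_nonneg cantor_le_1 by (simp add: f_def)
qed

section \<open>Random distribution functions\<close>

text \<open>Preimages of a countable basis under countably many maps are again countably many sets.
  Their Marczewski function generates the same \<sigma>-algebra as all the \<open>D q\<close>
  together; this is the source of \<Theta>.\<close>

lemma countable_real_maps_code:
  fixes D :: "'q::countable \<Rightarrow> 'a \<Rightarrow> real"
  assumes D: "\<And>q. D q \<in> borel_measurable M"
  obtains \<theta> :: "'a \<Rightarrow> real" where "\<theta> \<in> borel_measurable M"
    "\<And>q. D q \<in> borel_measurable (vimage_algebra (space M) \<theta> borel)"
proof -
  obtain U :: "real set set" where U: "countable U" "topological_basis U"
    using ex_countable_basis by blast
  define C where "C = (\<lambda>(q, u). D q -` u \<inter> space M) ` (UNIV \<times> U)"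
  have bU: "borel = sigma UNIV U"
    using U by (rule borel_eq_countable_basis)
  have CM: "C \<subseteq> sets M"
  proof
    fix c assume "c \<in> C"
    then obtain q u where c: "c = D q -` u \<inter> space M" "u \<in> U"
      by (auto simp: C_def)
    then have "u \<in> sets borel"
      using U(2) by (auto intro: borel_open topological_basis_open)
    with c D show "c \<in> sets M"
      by (auto intro: measurable_sets)
  qed
  have C: "countable C" "C \<subseteq> Pow (space M)"
    using U(1) by (auto simp: C_def)
  obtain \<theta> :: "'a \<Rightarrow> real" where \<theta>: "sigma_sets (space M) C = {\<theta> -` S \<inter> space M |S. S \<in> sets borel}"
    by (rule countably_generated_imp_real_map[OF C])
  let ?V = "vimage_algebra (space M) \<theta> borel"
  have V: "sets ?V = sigma_sets (space M) C"
    unfolding \<theta> by (intro sets_vimage_algebra2) auto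
  show ?thesis
  proof (rule that)
    show "\<theta> \<in> borel_measurable M"
      using sets.sigma_sets_subset[OF CM] V by (simp add: measurable_iff_sets)
    show "D q \<in> borel_measurable ?V" for q
    proof -
      have "D q \<in> ?V \<rightarrow>\<^sub>M sigma UNIV U"
      proof (rule measurable_measure_of)
        show "D q -` u \<inter> space ?V \<in> sets ?V" if "u \<in> U" for u
        proof -
          have "D q -` u \<inter> space M \<in> C"
            using that by (auto simp: C_def)
          then show ?thesis
            by (simp add: V)
        qed
      qed auto
      then show ?thesis
        by (simp only: bU[symmetric])
    qed
  qed
qed

text \<open>The right-continuous version of a function that is monotone on the rationals; outside
  \<open>{0..<1}\<close> it is forced to be a distribution function.\<close>

definition cdf_of_rat :: "(rat \<Rightarrow> real) \<Rightarrow> real \<Rightarrow> real" where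
  "cdf_of_rat d x = (if x < 0 then 0 else if 1 \<le> x then 1 else INF q\<in>{q. x < of_rat q}. d q)"

locale rat_distribution =
  fixes d :: "rat \<Rightarrow> real"
  assumes d_mono: "p \<le> q \<Longrightarrow> d p \<le> d q" and d_nonneg: "0 \<le> d q" and d_le_1: "d q \<le> 1"
begin

lemma bdd: "bdd_below (d ` Q)"
  using d_nonneg by (auto intro!: bdd_belowI[of _ 0])

lemma rats_above: "{q. (x::real) < of_rat q} \<noteq> {}"
  using of_rat_dense[of x "x + 1"] by auto

lemma cdf_of_rat_le: "x < of_rat q \<Longrightarrow> 0 \<le> x \<Longrightarrow> x < 1 \<Longrightarrow> cdf_of_rat d x \<le> d q"
  using bdd by (auto simp: cdf_of_rat_def intro!: cINF_lower)

lemma cdf_of_rat_01: "0 \<le> cdf_of_rat d x" "cdf_of_rat d x \<le> 1"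
proof -
  show "0 \<le> cdf_of_rat d x"
    using d_nonneg rats_above by (auto simp: cdf_of_rat_def intro!: cINF_greatest)
  obtain q where "x < of_rat q"
    using rats_above[of x] by auto
  then show "cdf_of_rat d x \<le> 1"
    using cdf_of_rat_le[of x q] d_le_1[of q] by (cases "0 \<le> x \<and> x < 1") (auto simp: cdf_of_rat_def)
qed

lemma cdf_of_rat_mono: "x \<le> y \<Longrightarrow> cdf_of_rat d x \<le> cdf_of_rat d y"
proof (cases "0 \<le> x \<and> y < 1")
  case True
  assume "x \<le> y"
  with True show ?thesis
    using bdd rats_above by (auto simp: cdf_of_rat_def intro!: cINF_superset_mono)
next
  case False
  assume "x \<le> y"
  with False show ?thesis
    using cdf_of_rat_01[of x] cdf_of_rat_01[of y] by (auto simp: cdf_of_rat_def)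
qed

lemma cdf_of_rat_approx:
  assumes "0 \<le> x" "x < 1" "0 < e"
  obtains q where "x < of_rat q" "d q < cdf_of_rat d x + e"
proof -
  have "(INF q\<in>{q. x < of_rat q}. d q) < cdf_of_rat d x + e"
    using assms by (simp add: cdf_of_rat_def)
  then show ?thesis
    using that by (auto simp: cINF_less_iff[OF rats_above bdd])
qed

lemma continuous_cdf_of_rat: "continuous (at_right x) (cdf_of_rat d)"
proof (subst continuous_at_right_real_increasing)
  show "\<forall>e>0. \<exists>\<delta>>0. cdf_of_rat d (x + \<delta>) - cdf_of_rat d x < e"
  proof (intro allI impI)
    fix e :: real assume e: "0 < e"
    consider "x < 0" | "1 \<le> x" | "0 \<le> x" "x < 1" by linarith
    then show "\<exists>\<delta>>0. cdf_of_rat d (x + \<delta>) - cdf_of_rat d x < e"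
    proof cases
      case 1
      then show ?thesis using e by (intro exI[of _ "- x / 2"]) (auto simp: cdf_of_rat_def)
    next
      case 2
      then show ?thesis using e by (intro exI[of _ 1]) (auto simp: cdf_of_rat_def)
    next
      case 3
      obtain q where q: "x < of_rat q" "d q < cdf_of_rat d x + e"
        using cdf_of_rat_approx[OF 3 e] by blast
      define r :: real where "r = of_rat q"
      have r: "x < r" using q by (simp add: r_def)
      \<comment> \<open>Half the smaller distance keeps \<open>x + \<delta>\<close> below
        \<open>r\<close>, where \<open>d q\<close> bounds the value, and below 1, where the infimum
        formula is in force.\<close>
      define \<delta> where "\<delta> = min (r - x) (1 - x) / 2"
      have \<delta>: "0 < \<delta>" "x + \<delta> < r" "x + \<delta> < 1"
      proof -
        have le: "\<delta> \<le> (r - x) / 2" "\<delta> \<le> (1 - x) / 2"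
          by (auto simp: \<delta>_def)
        show "x + \<delta> < r" using r le by (simp add: field_simps)
        show "x + \<delta> < 1" using 3 le by (simp add: field_simps)
      qed (use r 3 in \<open>auto simp: \<delta>_def\<close>)
      then have "cdf_of_rat d (x + \<delta>) \<le> d q"
        using 3 by (intro cdf_of_rat_le) (auto simp: r_def)
      with q \<delta> show ?thesis
        by (intro exI[of _ \<delta>]) auto
    qed
  qed
qed (rule cdf_of_rat_mono)

text \<open>Each \<open>d (q n)\<close> is a term of the infimum, and \<open>q n\<close> eventually
  falls below any rational that nearly attains it.\<close>

lemma tendsto_cdf_of_rat:
  assumes x: "0 \<le> x" "x < 1" and q: "\<And>n. x < of_rat (q n)" "(\<lambda>n. of_rat (q n)) \<longlonglongrightarrow> x"
  shows "(\<lambda>n. d (q n)) \<longlonglongrightarrow> cdf_of_rat d x"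
proof (rule order_tendstoI)
  fix a assume "a < cdf_of_rat d x"
  then show "\<forall>\<^sub>F n in sequentially. a < d (q n)"
    using cdf_of_rat_le[OF q(1) x] by (intro always_eventually allI) (rule less_le_trans)
next
  fix a assume "cdf_of_rat d x < a"
  then obtain p where p: "x < of_rat p" "d p < a"
    using cdf_of_rat_approx[OF x, of "a - cdf_of_rat d x"] by auto
  have "\<forall>\<^sub>F n in sequentially. of_rat (q n) < (of_rat p :: real)"
    using q(2) p(1) by (rule order_tendstoD)
  then show "\<forall>\<^sub>F n in sequentially. d (q n) < a"
  proof eventually_elim
    case (elim n)
    then have "d (q n) \<le> d p"
      by (intro d_mono) (simp add: of_rat_less)
    with p(2) show ?case by simp
  qed
qed

lemma cdf_of_rat_lims: "(cdf_of_rat d \<longlongrightarrow> 0) at_bot" "(cdf_of_rat d \<longlongrightarrow> 1) at_top"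
proof -
  have "\<forall>\<^sub>F x in at_bot. cdf_of_rat d x = 0"
    using eventually_gt_at_bot[of 0] by eventually_elim (simp add: cdf_of_rat_def)
  then show "(cdf_of_rat d \<longlongrightarrow> 0) at_bot"
    by (rule tendsto_eventually)
  have "\<forall>\<^sub>F x in at_top. cdf_of_rat d x = 1"
    using eventually_ge_at_top[of 1] by eventually_elim (simp add: cdf_of_rat_def)
  then show "(cdf_of_rat d \<longlongrightarrow> 1) at_top"
    by (rule tendsto_eventually)
qed

lemma real_distribution_cdf_of_rat: "real_distribution (interval_measure (cdf_of_rat d))"
  by (intro real_distribution_interval_measure cdf_of_rat_mono continuous_cdf_of_rat cdf_of_rat_lims)

lemma measure_cdf_of_rat: "measure (interval_measure (cdf_of_rat d)) {..x} = cdf_of_rat d x"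
  by (intro measure_interval_measure_Iic cdf_of_rat_mono continuous_cdf_of_rat cdf_of_rat_lims)

end

lemma measurable_cdf_of_rat:
  assumes [measurable]: "\<And>q. D q \<in> borel_measurable M" and nn: "\<And>q \<omega>. 0 \<le> D q \<omega>"
  shows "(\<lambda>\<omega>. cdf_of_rat (\<lambda>q. D q \<omega>) x) \<in> borel_measurable M"
proof -
  have "(\<lambda>\<omega>. INF q\<in>{q. x < of_rat q}. D q \<omega>) \<in> borel_measurable M"
    using nn by (intro borel_measurable_cINF) (auto intro!: bdd_belowI[of _ 0])
  then show ?thesis
    unfolding cdf_of_rat_def by simp
qed

text \<open>For fixed \<open>A\<close> both sides are finite Borel measures in \<open>S\<close>: the
  law of \<open>Z\<close> on \<open>A\<close>, and the mixture of the \<open>K \<omega>\<close> over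
  \<open>A\<close>. Half-lines form an intersection-stable generator, so agreement on them
  suffices.\<close>

lemma bind_distr_eqI_atMost:
  fixes Z :: "'a \<Rightarrow> real"
  assumes P: "prob_space P" and A: "A \<in> sets P" and Z: "Z \<in> borel_measurable P"
    and K: "K \<in> P \<rightarrow>\<^sub>M prob_algebra borel"
    and eq: "\<And>x. (\<integral>\<omega>. indicator A \<omega> * measure (K \<omega>) {..x} \<partial>P) = (\<integral>\<omega>. indicator A \<omega> * indicator {..x} (Z \<omega>) \<partial>P)"
    and S: "S \<in> sets borel"
  shows "(\<integral>\<omega>. indicator A \<omega> * measure (K \<omega>) S \<partial>P) = (\<integral>\<omega>. indicator A \<omega> * indicator S (Z \<omega>) \<partial>P)"
proof -
  interpret prob_space P by fact
  note [measurable] = A Z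
  have K': "K \<in> P \<rightarrow>\<^sub>M subprob_algebra borel"
    using K by (rule measurable_prob_algebraD)
  have Kp: "prob_space (K \<omega>)" if "\<omega> \<in> space P" for \<omega>
    using measurable_space[OF K that] by (simp add: space_prob_algebra)
  have Km [measurable]: "(\<lambda>\<omega>. measure (K \<omega>) S) \<in> borel_measurable P" if "S \<in> sets borel" for S
    using measurable_compose[OF K' measurable_measure_subprob_algebra[OF that]] .
  define D where "D = density P (indicator A)"
  define N1 where "N1 = distr D borel Z"
  define N2 where "N2 = D \<bind> K"
  have KD: "K \<in> D \<rightarrow>\<^sub>M subprob_algebra borel"
    using K' by (simp add: D_def)
  have N1: "emeasure N1 S = ennreal (\<integral>\<omega>. indicator A \<omega> * indicator S (Z \<omega>) \<partial>P)" if S: "S \<in> sets borel" for S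
  proof -
    have ZS: "Z -` S \<inter> space P \<in> events"
      using Z S by (rule measurable_sets)
    have "emeasure N1 S = emeasure D (Z -` S \<inter> space P)"
      unfolding N1_def using S by (subst emeasure_distr) (auto simp: D_def)
    also have "\<dots> = (\<integral>\<^sup>+\<omega>. indicator A \<omega> * indicator (Z -` S \<inter> space P) \<omega> \<partial>P)"
      unfolding D_def using ZS by (intro emeasure_density) auto
    also have "\<dots> = (\<integral>\<^sup>+\<omega>. ennreal (indicator A \<omega> * indicator S (Z \<omega>)) \<partial>P)"
      by (intro nn_integral_cong) (auto simp: indicator_def)
    also have "\<dots> = ennreal (\<integral>\<omega>. indicator A \<omega> * indicator S (Z \<omega>) \<partial>P)"
    proof (intro nn_integral_eq_integral integrable_bounded_01)
      show "(\<lambda>\<omega>. indicator A \<omega> * indicator S (Z \<omega>) :: real) \<in> borel_measurable P"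
        using S by measurable
    qed (auto simp: indicator_def)
    finally show ?thesis .
  qed
  have N2: "emeasure N2 S = ennreal (\<integral>\<omega>. indicator A \<omega> * measure (K \<omega>) S \<partial>P)" if S: "S \<in> sets borel" for S
  proof -
    have "emeasure N2 S = (\<integral>\<^sup>+\<omega>. emeasure (K \<omega>) S \<partial>D)"
      unfolding N2_def using S KD not_empty by (intro emeasure_bind) (auto simp: D_def)
    also have "\<dots> = (\<integral>\<^sup>+\<omega>. indicator A \<omega> * emeasure (K \<omega>) S \<partial>P)"
      unfolding D_def using S measurable_compose[OF K' measurable_emeasure_subprob_algebra]
      by (intro nn_integral_density) auto
    also have "\<dots> = (\<integral>\<^sup>+\<omega>. ennreal (indicator A \<omega> * measure (K \<omega>) S) \<partial>P)"
    proof (intro nn_integral_cong)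
      fix \<omega> assume "\<omega> \<in> space P"
      then interpret K: prob_space "K \<omega>" by (rule Kp)
      show "indicator A \<omega> * emeasure (K \<omega>) S = ennreal (indicator A \<omega> * measure (K \<omega>) S)"
        by (simp add: K.emeasure_eq_measure indicator_def)
    qed
    also have "\<dots> = ennreal (\<integral>\<omega>. indicator A \<omega> * measure (K \<omega>) S \<partial>P)"
    proof (intro nn_integral_eq_integral integrable_const_bound[of _ 1])
      show "(\<lambda>\<omega>. indicator A \<omega> * measure (K \<omega>) S) \<in> borel_measurable P"
        using S by measurable
      show "AE \<omega> in P. norm (indicator A \<omega> * measure (K \<omega>) S) \<le> 1"
        using prob_space.prob_le_1[OF Kp] by (auto simp: indicator_def)
    qed auto
    finally show ?thesis .
  qed
  have sets2: "sets N2 = sets borel"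
    unfolding N2_def using KD not_empty by (intro sets_bind[where N=borel]) (auto simp: D_def dest: sets_kernel)
  have "N1 = N2"
  proof (rule measure_eqI_generator_eq[where \<Omega>=UNIV and E="range atMost" and A="\<lambda>n::nat. {..real n}"])
    show "Int_stable (range (atMost :: real \<Rightarrow> real set))"
      by (auto simp: Int_stable_def)
    show "emeasure N1 B = emeasure N2 B" if "B \<in> range atMost" for B
      using that eq by (auto simp: N1 N2)
    show "(\<Union>n. {..real n}) = UNIV"
      by (auto intro: real_arch_simple)
    show "emeasure N1 {..real n} \<noteq> \<infinity>" for n
      by (simp add: N1)
  qed (auto simp: N1_def sets2 borel_eq_atMost)
  then have "ennreal (\<integral>\<omega>. indicator A \<omega> * measure (K \<omega>) S \<partial>P) = ennreal (\<integral>\<omega>. indicator A \<omega> * indicator S (Z \<omega>) \<partial>P)"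
    using N1[OF S] N2[OF S] by simp
  then show ?thesis
    by (subst (asm) ennreal_inj) (auto intro!: integral_nonneg_AE)
qed

section \<open>Kernels and product measures\<close>

context random_family
begin

definition joint :: "'a \<Rightarrow> 'i \<Rightarrow> 'b" where
  "joint \<omega> = (\<lambda>i\<in>I. X i \<omega>)"

lemma measurable_joint [measurable]: "joint \<in> P \<rightarrow>\<^sub>M (\<Pi>\<^sub>M i\<in>I. T)"
  unfolding joint_def by (intro measurable_restrict random_variable)

text \<open>It suffices to test cylinders, an intersection-stable generator, whose mass is a finite
  product of measurable functions of \<omega>.\<close>

lemma measurable_product_kernel:
  assumes Q: "Q \<in> F \<rightarrow>\<^sub>M prob_algebra T"
  shows "(\<lambda>\<omega>. \<Pi>\<^sub>M i\<in>I. Q \<omega>) \<in> F \<rightarrow>\<^sub>M prob_algebra (\<Pi>\<^sub>M i\<in>I. T)"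
proof (rule measurable_prob_algebra_generated[OF sets_PiM Int_stable_prod_algebra prod_algebra_sets_into_space])
  have Qp: "prob_space (Q \<omega>)" and Qs: "sets (Q \<omega>) = sets T" if "\<omega> \<in> space F" for \<omega>
    using measurable_space[OF Q that] by (auto simp: space_prob_algebra)
  show "prob_space (\<Pi>\<^sub>M i\<in>I. Q \<omega>)" if "\<omega> \<in> space F" for \<omega>
    using Qp[OF that] by (intro prob_space_PiM)
  show "sets (\<Pi>\<^sub>M i\<in>I. Q \<omega>) = sets (\<Pi>\<^sub>M i\<in>I. T)" if "\<omega> \<in> space F" for \<omega>
    using Qs[OF that] by (intro sets_PiM_cong) auto
  fix E assume "E \<in> prod_algebra I (\<lambda>_. T)"
  then obtain J C where E: "E = prod_emb I (\<lambda>_. T) J (Pi\<^sub>E J C)" and J: "finite J" "J \<subseteq> I"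
    and C: "\<And>j. j \<in> J \<Longrightarrow> C j \<in> sets T"
    by (rule prod_algebraE) auto
  have "emeasure (\<Pi>\<^sub>M i\<in>I. Q \<omega>) E = (\<Prod>j\<in>J. emeasure (Q \<omega>) (C j))" if \<omega>: "\<omega> \<in> space F" for \<omega>
  proof -
    interpret Q: prob_space "Q \<omega>" using Qp[OF \<omega>] .
    interpret product_prob_space "\<lambda>_. Q \<omega>" I ..
    have "E = prod_emb I (\<lambda>_. Q \<omega>) J (Pi\<^sub>E J C)"
      using sets_eq_imp_space_eq[OF Qs[OF \<omega>]] by (simp add: E prod_emb_def)
    then show ?thesis
      using J C Qs[OF \<omega>] by (simp add: emeasure_PiM_emb)
  qed
  moreover have "(\<lambda>\<omega>. \<Prod>j\<in>J. emeasure (Q \<omega>) (C j)) \<in> borel_measurable F"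
    using measurable_compose[OF measurable_prob_algebraD[OF Q] measurable_emeasure_subprob_algebra] C
    by (intro borel_measurable_prod_ennreal) auto
  ultimately show "(\<lambda>\<omega>. emeasure (\<Pi>\<^sub>M i\<in>I. Q \<omega>) E) \<in> borel_measurable F"
    by (simp cong: measurable_cong)
qed

text \<open>For cylinders this is the identity in \<open>directed_by\<close>. Both sides are finite
  measures in \<open>H\<close>, so it extends to the whole product \<sigma>-algebra.\<close>

lemma directed_by_kernel_imp_product:
  assumes W: "directed_by F (\<lambda>B \<omega>. measure (Q \<omega>) B)" and Q: "Q \<in> F \<rightarrow>\<^sub>M prob_algebra T"
    and A: "A \<in> sets F" and H: "H \<in> sets (\<Pi>\<^sub>M i\<in>I. T)"
  shows "(\<integral>\<^sup>+\<omega>\<in>A. emeasure (\<Pi>\<^sub>M i\<in>I. Q \<omega>) H \<partial>(restr_to_subalg P F)) = emeasure P (A \<inter> joint -` H)"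
proof -
  have F: "subalgebra P F" using W by (simp add: directed_by_def)
  then have sF: "space F = space P" and AP [measurable]: "A \<in> events"
    using A by (auto simp: subalgebra_def)
  let ?N = "\<lambda>\<omega>. \<Pi>\<^sub>M i\<in>I. Q \<omega>"
  have NF: "?N \<in> F \<rightarrow>\<^sub>M subprob_algebra (\<Pi>\<^sub>M i\<in>I. T)"
    by (rule measurable_prob_algebraD[OF measurable_product_kernel[OF Q]])
  then have NP: "?N \<in> P \<rightarrow>\<^sub>M subprob_algebra (\<Pi>\<^sub>M i\<in>I. T)"
    using F by (rule measurable_from_subalg[rotated])
  have Qp: "prob_space (Q \<omega>)" and Qs: "sets (Q \<omega>) = sets T" if "\<omega> \<in> space P" for \<omega>
    using measurable_space[OF Q, of \<omega>] that by (auto simp: space_prob_algebra sF)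
  define D where "D = density P (indicator A)"
  define N1 where "N1 = distr D (\<Pi>\<^sub>M i\<in>I. T) joint"
  define N2 where "N2 = D \<bind> ?N"
  have ND: "?N \<in> D \<rightarrow>\<^sub>M subprob_algebra (\<Pi>\<^sub>M i\<in>I. T)"
    using NP by (simp add: D_def)
  have N1: "emeasure N1 H = emeasure P (A \<inter> joint -` H)" if H: "H \<in> sets (\<Pi>\<^sub>M i\<in>I. T)" for H
  proof -
    have JH: "joint -` H \<inter> space P \<in> events"
      using H by (rule measurable_sets[OF measurable_joint])
    have "emeasure N1 H = emeasure D (joint -` H \<inter> space P)"
      unfolding N1_def using H by (subst emeasure_distr) (auto simp: D_def)
    also have "\<dots> = (\<integral>\<^sup>+\<omega>. indicator A \<omega> * indicator (joint -` H \<inter> space P) \<omega> \<partial>P)"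
      unfolding D_def using JH by (intro emeasure_density) auto
    also have "\<dots> = (\<integral>\<^sup>+\<omega>. indicator (A \<inter> (joint -` H \<inter> space P)) \<omega> \<partial>P)"
      by (simp add: indicator_inter_arith)
    also have "\<dots> = emeasure P (A \<inter> (joint -` H \<inter> space P))"
      using JH by (intro nn_integral_indicator) auto
    also have "A \<inter> (joint -` H \<inter> space P) = A \<inter> joint -` H"
      using sets.sets_into_space[OF AP] by auto
    finally show ?thesis .
  qed
  have N2: "emeasure N2 H = (\<integral>\<^sup>+\<omega>. indicator A \<omega> * emeasure (?N \<omega>) H \<partial>P)"
    if H: "H \<in> sets (\<Pi>\<^sub>M i\<in>I. T)" for H
  proof -
    have "emeasure N2 H = (\<integral>\<^sup>+\<omega>. emeasure (?N \<omega>) H \<partial>D)"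
      unfolding N2_def using H ND not_empty by (intro emeasure_bind) (auto simp: D_def)
    also have "\<dots> = (\<integral>\<^sup>+\<omega>. indicator A \<omega> * emeasure (?N \<omega>) H \<partial>P)"
      unfolding D_def using measurable_compose[OF NP measurable_emeasure_subprob_algebra[OF H]]
      by (intro nn_integral_density) auto
    finally show ?thesis .
  qed
  have sets2: "sets N2 = sets (\<Pi>\<^sub>M i\<in>I. T)"
    unfolding N2_def using ND not_empty
    by (intro sets_bind[where N="\<Pi>\<^sub>M i\<in>I. T"]) (auto simp: D_def dest: sets_kernel)
  have "N1 = N2"
  proof (rule measure_eqI_PiM_infinite)
    fix C and J assume J: "finite J" "J \<subseteq> I" and C: "\<And>j. j \<in> J \<Longrightarrow> C j \<in> sets T"
    let ?H = "prod_emb I (\<lambda>_. T) J (Pi\<^sub>E J C)"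
    have H: "?H \<in> sets (\<Pi>\<^sub>M i\<in>I. T)"
      using J C by (intro sets_PiM_I) auto
    have m: "(\<lambda>\<omega>. \<Prod>j\<in>J. measure (Q \<omega>) (C j)) \<in> borel_measurable F"
      using W C by (intro borel_measurable_prod) (auto simp: directed_by_def)
    have le1: "measure (Q \<omega>) (C j) \<le> 1" if "j \<in> J" for j \<omega>
      using W C[OF that] by (auto simp: directed_by_def)
    have hm [measurable]: "hits X J C \<in> borel_measurable P"
      using J C random_variable by (intro measurable_hits[where T=T]) auto
    have "emeasure N1 ?H = emeasure P (A \<inter> joint -` ?H \<inter> space P)"
      using H sets.sets_into_space[OF AP] by (subst N1) (auto intro!: arg_cong2[where f=emeasure])
    also have "\<dots> = (\<integral>\<^sup>+\<omega>. indicator (A \<inter> joint -` ?H \<inter> space P) \<omega> \<partial>P)"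
      using measurable_sets[OF measurable_joint H]
      by (subst nn_integral_indicator) (auto simp: Int_assoc)
    also have "\<dots> = (\<integral>\<^sup>+\<omega>. ennreal (indicator A \<omega> * hits X J C \<omega>) \<partial>P)"
    proof (intro nn_integral_cong)
      fix \<omega> assume \<omega>: "\<omega> \<in> space P"
      have "joint \<omega> \<in> space (\<Pi>\<^sub>M i\<in>I. T)"
        using \<omega> measurable_space[OF measurable_joint] by blast
      then have "joint \<omega> \<in> ?H \<longleftrightarrow> (\<forall>j\<in>J. X j \<omega> \<in> C j)"
        using J by (auto simp: prod_emb_def space_PiM PiE_iff joint_def)
      then show "indicator (A \<inter> joint -` ?H \<inter> space P) \<omega> = ennreal (indicator A \<omega> * hits X J C \<omega>)"
        using \<omega> J(1) by (simp add: hits_eq_of_bool indicator_def)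
    qed
    also have "\<dots> = ennreal (\<integral>\<omega>. indicator A \<omega> * hits X J C \<omega> \<partial>P)"
      using hits_nonneg[of X J C] hits_le_1[of X J C]
      by (intro nn_integral_eq_integral integrable_bounded_01) (auto intro!: mult_le_one)
    also have "(\<integral>\<omega>. indicator A \<omega> * hits X J C \<omega> \<partial>P) = (\<integral>\<omega>. indicator A \<omega> * (\<Prod>j\<in>J. measure (Q \<omega>) (C j)) \<partial>P)"
      using W A J C unfolding directed_by_def by blast
    also have "ennreal \<dots> = (\<integral>\<^sup>+\<omega>. ennreal (indicator A \<omega> * (\<Prod>j\<in>J. measure (Q \<omega>) (C j))) \<partial>P)"
      using measurable_from_subalg[OF F m] le1
      by (intro nn_integral_eq_integral[symmetric] integrable_bounded_01)
         (auto intro!: mult_le_one prod_le_1 prod_nonneg mult_nonneg_nonneg)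
    also have "\<dots> = (\<integral>\<^sup>+\<omega>. indicator A \<omega> * emeasure (?N \<omega>) ?H \<partial>P)"
    proof (intro nn_integral_cong)
      fix \<omega> assume \<omega>: "\<omega> \<in> space P"
      interpret Q: prob_space "Q \<omega>" using Qp[OF \<omega>] .
      interpret product_prob_space "\<lambda>_. Q \<omega>" I ..
      have "?H = prod_emb I (\<lambda>_. Q \<omega>) J (Pi\<^sub>E J C)"
        using sets_eq_imp_space_eq[OF Qs[OF \<omega>]] by (simp add: prod_emb_def)
      then have "emeasure (?N \<omega>) ?H = (\<Prod>j\<in>J. emeasure (Q \<omega>) (C j))"
        using J C Qs[OF \<omega>] by (simp add: emeasure_PiM_emb)
      also have "\<dots> = ennreal (\<Prod>j\<in>J. measure (Q \<omega>) (C j))"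
        by (simp add: Q.emeasure_eq_measure prod_ennreal)
      finally show "ennreal (indicator A \<omega> * (\<Prod>j\<in>J. measure (Q \<omega>) (C j))) = indicator A \<omega> * emeasure (?N \<omega>) ?H"
        by (simp add: indicator_def)
    qed
    also have "\<dots> = emeasure N2 ?H"
      using N2[OF H] by simp
    finally show "emeasure N1 ?H = emeasure N2 ?H" .
  next
    have "emeasure N1 (space (\<Pi>\<^sub>M i\<in>I. T)) \<noteq> \<infinity>"
      by (subst N1) (auto simp: emeasure_eq_measure)
    then show "finite_measure N1"
      by (intro finite_measureI) (simp add: N1_def)
  qed (simp_all add: sets2 N1_def)
  then have "emeasure P (A \<inter> joint -` H) = (\<integral>\<^sup>+\<omega>. indicator A \<omega> * emeasure (?N \<omega>) H \<partial>P)"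
    using N1[OF H] N2[OF H] by simp
  \<comment> \<open>The integrand is \<open>F\<close>-measurable, so \<open>P\<close> may be
    replaced by its restriction to \<open>F\<close>.\<close>
  also have "\<dots> = (\<integral>\<^sup>+\<omega>. indicator A \<omega> * emeasure (?N \<omega>) H \<partial>(restr_to_subalg P F))"
    using A measurable_compose[OF NF measurable_emeasure_subprob_algebra[OF H]]
    by (intro nn_integral_subalgebra2[symmetric] F) auto
  finally show ?thesis
    by (simp add: mult.commute)
qed

end

section \<open>A directing kernel for perfect laws on a countably generated space\<close>

context exchangeable_sequence
begin

text \<open>The single variable \<open>X (s 0)\<close> is enough to identify the kernel with
  \<open>freq\<close> almost surely, set by set; the joint statement is then inherited from
  \<open>integral_tail_hits\<close>.\<close>

lemma ex_directing_kernel: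
  fixes f :: "'b \<Rightarrow> real"
  assumes f01: "\<And>y. 0 \<le> f y" "\<And>y. f y \<le> 1"
    and Tf: "sets T = {f -` S \<inter> space T |S. S \<in> sets borel}"
    and perf: "perfect (distr P T (X (s 0)))"
  obtains \<theta> :: "'a \<Rightarrow> real" and Q where "\<theta> \<in> borel_measurable P"
    "Q \<in> gen_sigma P borel \<theta> \<rightarrow>\<^sub>M prob_algebra T"
    "directed_by (gen_sigma P borel \<theta>) (\<lambda>B \<omega>. measure (Q \<omega>) B)"
proof -
  note X0 [measurable] = random_variable[OF s_in[of 0]]
  have f [measurable]: "f \<in> borel_measurable T"
  proof (rule measurableI)
    show "f -` S \<inter> space T \<in> sets T" if "S \<in> sets borel" for S
      using that unfolding Tf by blast
  qed simp
  define Z where "Z \<omega> = f (X (s 0) \<omega>)" for \<omega>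
  have Z [measurable]: "Z \<in> borel_measurable P"
    unfolding Z_def[abs_def] by measurable
  define lev where "lev q = {y \<in> space T. f y \<le> q}" for q
  have lev [measurable]: "lev q \<in> sets T" for q
    unfolding lev_def by measurable
  define D where "D q \<omega> = freq (lev (of_rat q)) \<omega>" for q :: rat and \<omega>
  have Dtail: "D q \<in> borel_measurable tail" for q
    unfolding D_def[abs_def] by (intro measurable_freq lev)
  \<comment> \<open>\<open>\<theta>\<close> is chosen tail-measurable, so that every event it
    generates is a tail event and the tail identities hold over it.\<close>
  obtain \<theta> :: "'a \<Rightarrow> real" where \<theta>tail: "\<theta> \<in> borel_measurable tail"
    and D: "\<And>q. D q \<in> borel_measurable (gen_sigma P borel \<theta>)"
    by (rule countable_real_maps_code[where D=D and M=tail, unfolded space_tail]) (use Dtail in auto)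
  define V where "V = gen_sigma P borel \<theta>"
  have sV: "space V = space P"
    by (simp add: V_def)
  have Vtail: "A \<in> sets tail" if "A \<in> sets V" for A
    using \<theta>tail that unfolding V_def measurable_iff_sets by auto
  have subV: "subalgebra P V"
    using Vtail tail_in_events by (auto simp: subalgebra_def sV)
  have subVt: "subalgebra tail V"
    using Vtail by (auto simp: subalgebra_def sV)
  define K where "K \<omega> = interval_measure (cdf_of_rat (\<lambda>q. D q \<omega>))" for \<omega>
  have rd: "rat_distribution (\<lambda>q. D q \<omega>)" for \<omega>
  proof
    show "D p \<omega> \<le> D q \<omega>" if "p \<le> q" for p q
      unfolding D_def using that by (intro freq_mono) (auto simp: lev_def of_rat_less_eq intro: order_trans)
  qed (auto simp: D_def freq_nonneg freq_le_1)
  have Kdist: "real_distribution (K \<omega>)" for \<omega>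
    unfolding K_def by (rule rat_distribution.real_distribution_cdf_of_rat[OF rd])
  have Kp: "prob_space (K \<omega>)" for \<omega>
    using Kdist by (simp add: real_distribution_def)
  have Ks: "sets (K \<omega>) = sets borel" for \<omega>
    by (simp add: K_def)
  have Kx: "measure (K \<omega>) {..x} = cdf_of_rat (\<lambda>q. D q \<omega>) x" for \<omega> x
    unfolding K_def by (rule rat_distribution.measure_cdf_of_rat[OF rd])
  have cdfV: "(\<lambda>\<omega>. cdf_of_rat (\<lambda>q. D q \<omega>) x) \<in> borel_measurable V" for x
    using D unfolding V_def by (rule measurable_cdf_of_rat) (simp add: D_def freq_nonneg)
  have KV: "K \<in> V \<rightarrow>\<^sub>M prob_algebra borel"
  proof (rule measurable_prob_algebra_generated[where G="range atMost" and \<Omega>=UNIV])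
    show "sets borel = sigma_sets UNIV (range (atMost :: real \<Rightarrow> _))"
      by (simp add: borel_eq_atMost)
    show "Int_stable (range (atMost :: real \<Rightarrow> real set))"
      by (auto simp: Int_stable_def)
    fix B :: "real set" assume "B \<in> range atMost"
    then obtain x where B: "B = {..x}" by blast
    have "emeasure (K \<omega>) B = ennreal (cdf_of_rat (\<lambda>q. D q \<omega>) x)" for \<omega>
    proof -
      interpret K: prob_space "K \<omega>" by (rule Kp)
      show ?thesis by (simp add: B K.emeasure_eq_measure Kx)
    qed
    then show "(\<lambda>\<omega>. emeasure (K \<omega>) B) \<in> borel_measurable V"
      using cdfV by simp
  qed (auto simp: Kp Ks)
  then have KP: "K \<in> P \<rightarrow>\<^sub>M prob_algebra borel"
    by (rule measurable_from_subalg[OF subV])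
  have int_freq: "(\<integral>\<omega>. indicator A \<omega> * freq B \<omega> \<partial>P) = (\<integral>\<omega>. indicator A \<omega> * indicator B (X (s 0) \<omega>) \<partial>P)"
    if A: "A \<in> sets tail" and B: "B \<in> sets T" for A B
  proof -
    have "(\<integral>\<omega>. indicator A \<omega> * hits X {s 0} (\<lambda>_. B) \<omega> \<partial>P) = (\<integral>\<omega>. indicator A \<omega> * (\<Prod>i\<in>{s 0}. freq B \<omega>) \<partial>P)"
      using A B s_in by (intro integral_tail_hits) auto
    then show ?thesis by (simp add: hits_def)
  qed
  have int_atMost: "(\<integral>\<omega>. indicator A \<omega> * measure (K \<omega>) {..x} \<partial>P) = (\<integral>\<omega>. indicator A \<omega> * indicator {..x} (Z \<omega>) \<partial>P)"
    if A: "A \<in> sets tail" for A x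
  proof -
    note [measurable] = tail_in_events[OF A]
    \<comment> \<open>\<open>f\<close> has values in [0, 1], so the first two cases agree with the
      values forced on \<open>cdf_of_rat\<close>. In the third, rationals strictly above
      \<open>x\<close> tend to \<open>x\<close>, as the infimum requires, and both sides converge by
      dominated convergence.\<close>
    consider "x < 0" | "1 \<le> x" | "0 \<le> x" "x < 1" by linarith
    then show ?thesis
    proof cases
      case 1
      then have "indicator {..x} (Z \<omega>) = (0::real)" for \<omega>
        using f01(1)[of "X (s 0) \<omega>"] by (auto simp: Z_def indicator_def)
      with 1 show ?thesis by (simp add: Kx cdf_of_rat_def)
    next
      case 2
      then have "indicator {..x} (Z \<omega>) = (1::real)" for \<omega>
        using f01(2)[of "X (s 0) \<omega>"] by (auto simp: Z_def indicator_def)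
      with 2 show ?thesis by (simp add: Kx cdf_of_rat_def)
    next
      case 3
      have "\<exists>q. x < of_rat q \<and> of_rat q < x + 1 / Suc n" for n
        by (intro of_rat_dense) simp
      then obtain q where q: "\<And>n. x < of_rat (q n)" "\<And>n. of_rat (q n) < x + 1 / Suc n"
        by metis
      have qx: "(\<lambda>n. of_rat (q n)) \<longlonglongrightarrow> x"
      proof (rule tendsto_sandwich[of "\<lambda>_. x" _ _ "\<lambda>n. x + 1 / Suc n"])
        show "(\<lambda>n. x + 1 / Suc n) \<longlonglongrightarrow> x"
          using tendsto_add[OF tendsto_const LIMSEQ_inverse_real_of_nat, of x] by (simp add: inverse_eq_divide)
      qed (use q in \<open>auto intro!: always_eventually less_imp_le\<close>)
      have eq: "(\<integral>\<omega>. indicator A \<omega> * D (q n) \<omega> \<partial>P) = (\<integral>\<omega>. indicator A \<omega> * indicator {..of_rat (q n)} (Z \<omega>) \<partial>P)" for n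
      proof -
        have "(\<integral>\<omega>. indicator A \<omega> * D (q n) \<omega> \<partial>P) = (\<integral>\<omega>. indicator A \<omega> * indicator (lev (of_rat (q n))) (X (s 0) \<omega>) \<partial>P)"
          unfolding D_def by (intro int_freq A lev)
        also have "\<dots> = (\<integral>\<omega>. indicator A \<omega> * indicator {..of_rat (q n)} (Z \<omega>) \<partial>P)"
          using measurable_space[OF X0]
          by (intro Bochner_Integration.integral_cong) (auto simp: lev_def Z_def indicator_def)
        finally show ?thesis .
      qed
      have Dm [measurable]: "D p \<in> borel_measurable P" for p
        by (rule measurable_tailD[OF Dtail])
      have "(\<lambda>n. \<integral>\<omega>. indicator A \<omega> * D (q n) \<omega> \<partial>P) \<longlonglongrightarrow> (\<integral>\<omega>. indicator A \<omega> * cdf_of_rat (\<lambda>q. D q \<omega>) x \<partial>P)"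
      proof (rule integral_dominated_convergence[where w="\<lambda>_. 1"])
        show "AE \<omega> in P. (\<lambda>n. indicator A \<omega> * D (q n) \<omega>) \<longlonglongrightarrow> indicator A \<omega> * cdf_of_rat (\<lambda>q. D q \<omega>) x"
          using rat_distribution.tendsto_cdf_of_rat[OF rd 3 q(1) qx]
          by (intro always_eventually allI tendsto_mult tendsto_const)
        show "AE \<omega> in P. norm (indicator A \<omega> * D (q n) \<omega>) \<le> 1" for n
          by (auto simp: indicator_def D_def freq_nonneg freq_le_1)
        show "(\<lambda>\<omega>. indicator A \<omega> * cdf_of_rat (\<lambda>q. D q \<omega>) x) \<in> borel_measurable P"
          using measurable_from_subalg[OF subV cdfV] by measurable
      qed auto
      moreover have "(\<lambda>n. \<integral>\<omega>. indicator A \<omega> * indicator {..of_rat (q n)} (Z \<omega>) \<partial>P)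
          \<longlonglongrightarrow> (\<integral>\<omega>. indicator A \<omega> * (indicator {..x} (Z \<omega>) :: real) \<partial>P)"
      proof (rule integral_dominated_convergence[where w="\<lambda>_. 1"])
        have "(\<lambda>n. indicator {..of_rat (q n)} z) \<longlonglongrightarrow> (indicator {..x} z :: real)" for z
        proof (rule tendsto_eventually, cases "z \<le> x")
          case True
          then show "\<forall>\<^sub>F n in sequentially. indicator {..of_rat (q n)} z = (indicator {..x} z :: real)"
            using q(1) by (auto simp: indicator_def intro!: always_eventually dest: le_less_trans less_imp_le)
        next
          case False
          then have "\<forall>\<^sub>F n in sequentially. of_rat (q n) < z"
            using qx by (intro order_tendstoD) auto
          then show "\<forall>\<^sub>F n in sequentially. indicator {..of_rat (q n)} z = (indicator {..x} z :: real)"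
            by eventually_elim (use False in auto)
        qed
        then show "AE \<omega> in P. (\<lambda>n. indicator A \<omega> * indicator {..of_rat (q n)} (Z \<omega>)) \<longlonglongrightarrow> (indicator A \<omega> * indicator {..x} (Z \<omega>) :: real)"
          by (intro always_eventually allI tendsto_mult tendsto_const)
        show "AE \<omega> in P. norm (indicator A \<omega> * indicator {..of_rat (q n)} (Z \<omega>) :: real) \<le> 1" for n
          by (auto simp: indicator_def)
      qed auto
      ultimately show ?thesis
        unfolding eq Kx by (rule LIMSEQ_unique)
    qed
  qed
  have int_K: "(\<integral>\<omega>. indicator A \<omega> * measure (K \<omega>) S \<partial>P) = (\<integral>\<omega>. indicator A \<omega> * indicator S (Z \<omega>) \<partial>P)"
    if "A \<in> sets tail" "S \<in> sets borel" for A S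
    by (rule bind_distr_eqI_atMost[OF prob_space_axioms tail_in_events[OF that(1)] Z KP int_atMost[OF that(1)] that(2)])
  obtain B0 where B0: "B0 \<in> sets borel" "B0 \<subseteq> f ` space T"
    and B01: "measure (distr P T (X (s 0))) (f -` B0 \<inter> space T) = 1"
    using perf f unfolding perfect_def by (metis measurable_distr_eq1 space_distr)
  have AEB0: "AE \<omega> in P. Z \<omega> \<in> B0"
  proof -
    have "prob (X (s 0) -` (f -` B0 \<inter> space T) \<inter> space P) = 1"
      using B01 B0(1) by (subst (asm) measure_distr) (auto intro: measurable_sets)
    then have "AE \<omega> in P. \<omega> \<in> X (s 0) -` (f -` B0 \<inter> space T) \<inter> space P"
      using B0(1) by (subst (asm) prob_eq_1) (auto intro: measurable_sets[OF X0] measurable_sets[OF f])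
    then show ?thesis by eventually_elim (auto simp: Z_def)
  qed
  obtain \<omega>0 where "\<omega>0 \<in> space P" using not_empty by blast
  \<comment> \<open>The default value of \<open>g\<close> off \<open>B0\<close>; a value of
    \<open>X (s 0)\<close> witnesses that \<open>space T\<close> is nonempty.\<close>
  define y0 where "y0 = X (s 0) \<omega>0"
  have y0: "y0 \<in> space T"
    unfolding y0_def using measurable_space[OF X0 \<open>\<omega>0 \<in> space P\<close>] .
  \<comment> \<open>Perfectness makes \<open>g\<close>, a right inverse of \<open>f\<close> on \<open>B0\<close>, measurable, so that \<open>K\<close> can be moved from
    the real line back to \<open>T\<close>.\<close>
  define g where "g x = (if x \<in> B0 then inv_into (space T) f x else y0)" for x
  have gT: "g x \<in> space T" for x
    using B0(2) y0 by (auto simp: g_def intro!: inv_into_into)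
  have fg: "f (g x) = x" if "x \<in> B0" for x
    using that B0(2) by (auto simp: g_def intro!: f_inv_into_f)
  have g: "g \<in> borel \<rightarrow>\<^sub>M T"
  proof (rule measurableI)
    fix B assume "B \<in> sets T"
    then obtain S where S: "S \<in> sets borel" "B = f -` S \<inter> space T"
      unfolding Tf by blast
    \<comment> \<open>Since \<open>f (g x) = x\<close> on \<open>B0\<close>, there
      \<open>g x\<close> lies in \<open>B\<close> exactly if \<open>x\<close> lies in
      \<open>S\<close>; off \<open>B0\<close> the condition is a constant one on
      \<open>y0\<close>.\<close>
    have "g -` B \<inter> space borel = (S \<inter> B0) \<union> (if y0 \<in> B then - B0 else {})"
    proof (rule set_eqI)
      fix x
      show "x \<in> g -` B \<inter> space borel \<longleftrightarrow> x \<in> (S \<inter> B0) \<union> (if y0 \<in> B then - B0 else {})"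
      proof (cases "x \<in> B0")
        case True
        then show ?thesis using gT[of x] fg[of x] by (simp add: S)
      next
        case False
        then show ?thesis by (simp add: g_def)
      qed
    qed
    then show "g -` B \<inter> space borel \<in> sets borel"
      using S(1) B0(1) by auto
  qed (rule gT)
  define Q where "Q \<omega> = distr (K \<omega>) T g" for \<omega>
  have QV: "Q \<in> V \<rightarrow>\<^sub>M prob_algebra T"
    unfolding Q_def[abs_def] using KV g by (intro measurable_distr_prob_space2[where M=borel]) auto
  have gK: "g \<in> K \<omega> \<rightarrow>\<^sub>M T" for \<omega>
    using g by (simp add: measurable_cong_sets[OF Ks refl])
  have Qp: "prob_space (Q \<omega>)" for \<omega>
    unfolding Q_def by (intro prob_space.prob_space_distr Kp gK)
  have QB: "measure (Q \<omega>) B = measure (K \<omega>) (g -` B)" if "B \<in> sets T" for B \<omega>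
    unfolding Q_def using that gK sets_eq_imp_space_eq[OF Ks, of \<omega>] by (subst measure_distr) auto
  have QVB: "(\<lambda>\<omega>. measure (Q \<omega>) B) \<in> borel_measurable V" if "B \<in> sets T" for B
    using measurable_compose[OF measurable_prob_algebraD[OF QV] measurable_measure_subprob_algebra[OF that]] .
  have QtB: "(\<lambda>\<omega>. measure (Q \<omega>) B) \<in> borel_measurable tail" if "B \<in> sets T" for B
    by (rule measurable_from_subalg[OF subVt QVB[OF that]])
  have Q1: "measure (Q \<omega>) B \<le> 1" for \<omega> B
    by (rule prob_space.prob_le_1[OF Qp])
  have intQ: "integrable P (\<lambda>\<omega>. measure (Q \<omega>) B)" if "B \<in> sets T" for B
    using measurable_tailD[OF QtB[OF that]] Q1 by (intro integrable_bounded_01) auto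
  have intf: "integrable P (freq B)" if "B \<in> sets T" for B
    using measurable_tailD[OF measurable_freq[OF that]] freq_nonneg freq_le_1 by (intro integrable_bounded_01)
  \<comment> \<open>Both functions are tail-measurable and have the same integral over each tail
    event \<open>A\<close>: the probability that \<open>A\<close> occurs and \<open>X (s 0)\<close>
    lies in \<open>B\<close>. The null set may depend on \<open>B\<close>, as
    \<open>directed_by\<close> involves only finitely many sets at a time.\<close>
  have Qfreq: "AE \<omega> in P. measure (Q \<omega>) B = freq B \<omega>" if B: "B \<in> sets T" for B
  proof -
    have "AE \<omega> in P. real_cond_exp P tail (freq B) \<omega> = measure (Q \<omega>) B"
    proof (rule tail.real_cond_exp_charact)
      fix A assume A: "A \<in> sets tail"
      obtain S where S: "S \<in> sets borel" "B = f -` S \<inter> space T"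
        using B unfolding Tf by blast
      have gB: "g -` B \<in> sets borel"
        using measurable_sets[OF g B] by simp
      note [measurable] = tail_in_events[OF A] B gB
      have "(\<integral>\<omega>\<in>A. freq B \<omega> \<partial>P) = (\<integral>\<omega>. indicator A \<omega> * indicator B (X (s 0) \<omega>) \<partial>P)"
        unfolding set_lebesgue_integral_def using int_freq[OF A B] by simp
      also have "\<dots> = (\<integral>\<omega>. indicator A \<omega> * indicator (g -` B) (Z \<omega>) \<partial>P)"
      proof (rule integral_cong_AE)
        show "AE \<omega> in P. indicator A \<omega> * indicator B (X (s 0) \<omega>) = (indicator A \<omega> * indicator (g -` B) (Z \<omega>) :: real)"
          using AEB0
        proof (rule AE_mp, intro AE_I2 impI)
          fix \<omega> assume \<omega>: "\<omega> \<in> space P" "Z \<omega> \<in> B0"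
          \<comment> \<open>\<open>g (Z \<omega>)\<close> may differ from
            \<open>X (s 0) \<omega>\<close>, but \<open>f\<close> agrees at both points, and a set
            of \<open>T\<close>, being a preimage under \<open>f\<close>, cannot separate
            them.\<close>
          have "X (s 0) \<omega> \<in> B \<longleftrightarrow> g (Z \<omega>) \<in> B"
            using fg[OF \<omega>(2)] gT measurable_space[OF X0 \<omega>(1)] by (auto simp: S Z_def)
          then show "indicator A \<omega> * indicator B (X (s 0) \<omega>) = (indicator A \<omega> * indicator (g -` B) (Z \<omega>) :: real)"
            by (simp add: indicator_def)
        qed
      qed measurable
      also have "\<dots> = (\<integral>\<omega>\<in>A. measure (Q \<omega>) B \<partial>P)"
        unfolding set_lebesgue_integral_def using int_K[OF A gB] by (simp add: QB[OF B])
      finally show "(\<integral>\<omega>\<in>A. freq B \<omega> \<partial>P) = (\<integral>\<omega>\<in>A. measure (Q \<omega>) B \<partial>P)" .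
    qed (use B intf intQ QtB in auto)
    moreover have "AE \<omega> in P. real_cond_exp P tail (freq B) \<omega> = freq B \<omega>"
      using intf[OF B] measurable_freq[OF B] by (rule tail.real_cond_exp_F_meas)
    ultimately show ?thesis by eventually_elim simp
  qed
  have "directed_by V (\<lambda>B \<omega>. measure (Q \<omega>) B)"
    unfolding directed_by_def
  proof (intro conjI ballI allI impI)
    fix A J and B :: "'i \<Rightarrow> 'b set"
    assume A: "A \<in> sets V" and J: "finite J" "J \<subseteq> I" and B: "\<forall>i\<in>J. B i \<in> sets T"
    note [measurable] = tail_in_events[OF Vtail[OF A]]
    have "(\<integral>\<omega>. indicator A \<omega> * hits X J B \<omega> \<partial>P) = (\<integral>\<omega>. indicator A \<omega> * (\<Prod>i\<in>J. freq (B i) \<omega>) \<partial>P)"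
      using J B Vtail[OF A] by (intro integral_tail_hits) auto
    also have "\<dots> = (\<integral>\<omega>. indicator A \<omega> * (\<Prod>i\<in>J. measure (Q \<omega>) (B i)) \<partial>P)"
    proof (rule integral_cong_AE)
      have "AE \<omega> in P. \<forall>i\<in>J. measure (Q \<omega>) (B i) = freq (B i) \<omega>"
        using B J by (intro AE_finite_allI Qfreq) auto
      then show "AE \<omega> in P. indicator A \<omega> * (\<Prod>i\<in>J. freq (B i) \<omega>) = indicator A \<omega> * (\<Prod>i\<in>J. measure (Q \<omega>) (B i))"
        by eventually_elim simp
      have "(\<lambda>\<omega>. \<Prod>i\<in>J. freq (B i) \<omega>) \<in> borel_measurable P" "(\<lambda>\<omega>. \<Prod>i\<in>J. measure (Q \<omega>) (B i)) \<in> borel_measurable P"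
        using B by (auto intro!: borel_measurable_prod measurable_tailD[OF measurable_freq] measurable_tailD[OF QtB])
      then show "(\<lambda>\<omega>. indicator A \<omega> * (\<Prod>i\<in>J. freq (B i) \<omega>)) \<in> borel_measurable P"
        "(\<lambda>\<omega>. indicator A \<omega> * (\<Prod>i\<in>J. measure (Q \<omega>) (B i))) \<in> borel_measurable P"
        by measurable
    qed
    finally show "(\<integral>\<omega>. indicator A \<omega> * hits X J B \<omega> \<partial>P) = (\<integral>\<omega>. indicator A \<omega> * (\<Prod>i\<in>J. measure (Q \<omega>) (B i)) \<partial>P)" .
  qed (use subV QVB Q1 in auto)
  then show ?thesis
    using that measurable_tailD[OF \<theta>tail] QV unfolding V_def by blast
qed

end

section \<open>Passage to vector-valued parameters and proof of the equivalences\<close>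

text \<open>The diagonal embedding of the line is Borel and has a Borel left inverse, the projection
  to any coordinate, here the one at \<open>undefined\<close>. A real parameter therefore serves in
  every dimension.\<close>

lemma gen_sigma_const_vec:
  fixes \<theta> :: "'a \<Rightarrow> real"
  shows "gen_sigma P borel (\<lambda>\<omega>. (\<chi> i. \<theta> \<omega>) :: real ^ 'd) = gen_sigma P borel \<theta>"
proof -
  let ?c = "\<lambda>r :: real. (\<chi> i. r) :: real ^ 'd"
  have c: "?c \<in> borel_measurable borel"
    by (intro borel_measurable_continuous_onI continuous_intros)
  have n: "(\<lambda>v :: real ^ 'd. v $ i) \<in> borel_measurable borel" for i
    by (intro borel_measurable_continuous_onI continuous_intros)
  have "{(\<lambda>\<omega>. ?c (\<theta> \<omega>)) -` A \<inter> space P |A. A \<in> sets borel} = {\<theta> -` A \<inter> space P |A. A \<in> sets borel}"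
  proof (intro equalityI subsetI; clarify)
    fix A :: "(real ^ 'd) set" assume "A \<in> sets borel"
    then have "?c -` A \<in> sets borel"
      using measurable_sets[OF c] by simp
    then show "\<exists>B. (\<lambda>\<omega>. ?c (\<theta> \<omega>)) -` A \<inter> space P = \<theta> -` B \<inter> space P \<and> B \<in> sets borel"
      by (intro exI[of _ "?c -` A"]) auto
  next
    fix A :: "real set" assume "A \<in> sets borel"
    then have "(\<lambda>v :: real ^ 'd. v $ undefined) -` A \<in> sets borel"
      using measurable_sets[OF n] by simp
    then show "\<exists>B. \<theta> -` A \<inter> space P = (\<lambda>\<omega>. ?c (\<theta> \<omega>)) -` B \<inter> space P \<and> B \<in> sets borel"
      by (intro exI[of _ "(\<lambda>v. v $ undefined) -` A"]) auto
  qed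
  then show ?thesis
    by (simp add: vimage_algebra_def)
qed

theorem theorem4p4:
  fixes P :: "'a measure" and T :: "'b measure"
    and X :: "'i \<Rightarrow> 'a \<Rightarrow> 'b" and I :: "'i set"
  assumes "prob_space P"
    and "infinite I"
    and "\<And>i. i \<in> I \<Longrightarrow> X i \<in> P \<rightarrow>\<^sub>M T"
  shows
    "let a1 = exchangeable P T X I;
         a2 = (\<exists>F. subalgebra P F \<and> cond_iid P F T X I);
         a3 = (\<exists>F Q. subalgebra P F \<and> Q \<in> F \<rightarrow>\<^sub>M prob_algebra T \<and>
                 (\<forall>H \<in> sets (\<Pi>\<^sub>M i\<in>I. T). \<forall>A \<in> sets F.
                    (\<integral>\<^sup>+\<omega>\<in>A. emeasure (\<Pi>\<^sub>M i\<in>I. Q \<omega>) H \<partial>(restr_to_subalg P F)) =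
                    emeasure P (A \<inter> (\<lambda>\<omega>. \<lambda>i\<in>I. X i \<omega>) -` H)));
         a4 = (\<exists>\<Theta> :: 'a \<Rightarrow> real ^ 'd. \<Theta> \<in> P \<rightarrow>\<^sub>M borel \<and>
                 cond_iid P (gen_sigma P borel \<Theta>) T X I)
     in (a1 \<longleftrightarrow> a2) \<and> (a3 \<longrightarrow> a1) \<and> (a4 \<longrightarrow> a1) \<and>
        (a1 \<or> a2 \<or> a3 \<or> a4 \<longrightarrow> (\<forall>i \<in> I. \<forall>j \<in> I. distr P T (X i) = distr P T (X j))) \<and>
        ((\<forall>i \<in> I. perfect (distr P T (X i))) \<and> countably_generated T \<longrightarrow>
           (a1 \<longleftrightarrow> a2) \<and> (a2 \<longleftrightarrow> a3) \<and> (a3 \<longleftrightarrow> a4))"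
proof -
  interpret random_family P T X I
    using assms by (intro random_family.intro random_family_axioms.intro)
  define a1 where "a1 = exchangeable P T X I"
  define a2 where "a2 = (\<exists>F. subalgebra P F \<and> cond_iid P F T X I)"
  define a3 where "a3 = (\<exists>F Q. subalgebra P F \<and> Q \<in> F \<rightarrow>\<^sub>M prob_algebra T \<and>
                 (\<forall>H \<in> sets (\<Pi>\<^sub>M i\<in>I. T). \<forall>A \<in> sets F.
                    (\<integral>\<^sup>+\<omega>\<in>A. emeasure (\<Pi>\<^sub>M i\<in>I. Q \<omega>) H \<partial>(restr_to_subalg P F)) =
                    emeasure P (A \<inter> (\<lambda>\<omega>. \<lambda>i\<in>I. X i \<omega>) -` H)))"
  define a4 where "a4 = (\<exists>\<Theta> :: 'a \<Rightarrow> real ^ 'd. \<Theta> \<in> P \<rightarrow>\<^sub>M borel \<and>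
                 cond_iid P (gen_sigma P borel \<Theta>) T X I)"
  have seq: "\<exists>s. exchangeable_sequence P T X I s" if a1
  proof -
    obtain s :: "nat \<Rightarrow> 'i" where "inj s" "range s \<subseteq> I"
      using infinite_countable_subset[OF \<open>infinite I\<close>] by blast
    with that have "exchangeable_sequence P T X I s"
      by unfold_locales (auto simp: a1_def)
    then show ?thesis by (intro exI)
  qed
  have 12: "a2" if a1: a1
  proof -
    obtain s where "exchangeable_sequence P T X I s"
      using seq[OF a1] by blast
    then interpret exchangeable_sequence P T X I s .
    show ?thesis
      unfolding a2_def using subalgebra_tail directed_by_imp_cond_iid[OF directed_by_tail_freq] by blast
  qed
  have 21: "a1" if a2
    using that cond_iid_imp_exchangeable unfolding a1_def a2_def by blast
  have 31: "a1" if a3: a3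
  proof -
    obtain F Q where F: "subalgebra P F" and Q: "Q \<in> F \<rightarrow>\<^sub>M prob_algebra T"
      and eq: "\<forall>H \<in> sets (\<Pi>\<^sub>M i\<in>I. T). \<forall>A \<in> sets F.
                    (\<integral>\<^sup>+\<omega>\<in>A. emeasure (\<Pi>\<^sub>M i\<in>I. Q \<omega>) H \<partial>(restr_to_subalg P F)) =
                    emeasure P (A \<inter> (\<lambda>\<omega>. \<lambda>i\<in>I. X i \<omega>) -` H)"
      using a3 unfolding a3_def by blast
    have sF: "space F = space P"
      using F by (simp add: subalgebra_def)
    have "space P \<in> sets F"
      using sets.top[of F] by (simp add: sF)
    with eq show ?thesis
      unfolding a1_def using measurable_space[OF Q]
      by (intro product_kernel_imp_exchangeable[OF _ F]) (auto simp: sF)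
  qed
  have 42: "a2" if a4: a4
  proof -
    obtain \<Theta> :: "'a \<Rightarrow> real ^ 'd" where \<Theta>: "\<Theta> \<in> P \<rightarrow>\<^sub>M borel" "cond_iid P (gen_sigma P borel \<Theta>) T X I"
      using a4 unfolding a4_def by blast
    \<comment> \<open>Measurability of \<open>\<Theta>\<close> puts its generated \<sigma>-algebra
      inside that of \<open>P\<close>, so \<open>a4\<close> is an instance of
      \<open>a2\<close>.\<close>
    then have "subalgebra P (gen_sigma P borel \<Theta>)"
      by (simp add: subalgebra_def measurable_iff_sets)
    with \<Theta>(2) show ?thesis
      unfolding a2_def by blast
  qed
  have 134: "a3 \<and> a4" if a1: a1 and perf: "\<forall>i\<in>I. perfect (distr P T (X i))" and cg: "countably_generated T"
  proof -
    obtain s where "exchangeable_sequence P T X I s"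
      using seq[OF a1] by blast
    then interpret exchangeable_sequence P T X I s .
    obtain C where C: "countable C" "C \<subseteq> Pow (space T)" "sets T = sigma_sets (space T) C"
      using cg unfolding countably_generated_def by blast
    obtain f :: "'b \<Rightarrow> real" where f: "\<And>y. 0 \<le> f y" "\<And>y. f y \<le> 1"
      "sigma_sets (space T) C = {f -` S \<inter> space T |S. S \<in> sets borel}"
      by (rule countably_generated_imp_real_map[OF C(1,2)]) blast
    \<comment> \<open>The \<sigma>-algebra of \<open>\<theta>\<close> serves twice: as
      \<open>F\<close> in \<open>a3\<close> with the kernel \<open>Q\<close>, and, after the
      diagonal embedding, as the \<sigma>-algebra of \<open>\<Theta>\<close> in
      \<open>a4\<close>.\<close>
    obtain \<theta> :: "'a \<Rightarrow> real" and Q where \<theta>: "\<theta> \<in> borel_measurable P"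
      and Q: "Q \<in> gen_sigma P borel \<theta> \<rightarrow>\<^sub>M prob_algebra T"
      and W: "directed_by (gen_sigma P borel \<theta>) (\<lambda>B \<omega>. measure (Q \<omega>) B)"
      using perf s_in by (rule_tac ex_directing_kernel[OF f(1,2) trans[OF C(3) f(3)]]) auto
    have a3
      unfolding a3_def using W Q directed_by_kernel_imp_product[OF W Q]
      by (intro exI[of _ "gen_sigma P borel \<theta>"] exI[of _ Q]) (auto simp: directed_by_def joint_def[abs_def])
    moreover have a4
      unfolding a4_def
    proof (intro exI conjI)
      show "(\<lambda>\<omega>. (\<chi> i. \<theta> \<omega>) :: real ^ 'd) \<in> P \<rightarrow>\<^sub>M borel"
        using \<theta> by (rule measurable_compose) (intro borel_measurable_continuous_onI continuous_intros)
      show "cond_iid P (gen_sigma P borel (\<lambda>\<omega>. (\<chi> i. \<theta> \<omega>) :: real ^ 'd)) T X I"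
        unfolding gen_sigma_const_vec using W by (rule directed_by_imp_cond_iid)
    qed
    ultimately show ?thesis ..
  qed
  have eq: "\<forall>i\<in>I. \<forall>j\<in>I. distr P T (X i) = distr P T (X j)" if a1
    using that exchangeable_imp_distr_eq unfolding a1_def by blast
  show ?thesis
    unfolding Let_def a1_def[symmetric] a2_def[symmetric] a3_def[symmetric] a4_def[symmetric]
    using 12 21 31 42 134 eq by blast
qed

end
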